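(* Let $\mu$ be a probability measure on a bounded metric space $X$, and let $\dim_{\mathrm{box}}(X)$ be the upper box dimension of $X$. If $0<\alpha<\dim_{\mathrm{box}}(X)$, then $$\dim_{\mathrm{PH}_0^\alpha}(\mu)\le\dim_{\mathrm{box}}(X).$$
   Context: For a bounded metric space $X$, $M_\delta(X)$ denotes the maximal number of pairwise disjoint open balls of radius $\delta$ centered at points of $X$, and the upper box dimension is $\dim_{\mathrm{box}}(X)=\limsup_{\delta\to0}\frac{\log(M_\delta(X))}{-\log(\delta)}$. For points $x_1,\ldots,x_n$ of $X$, fix one of two filtrations (the claim holds for either): the Čech complex, whose simplices at scale $\epsilon>0$ are the nonempty subsets $\{y_1,\ldots,y_k\}$ of $\{x_1,\ldots,x_n\}$ with $\bigcap_jB_\epsilon(y_j)\neq\varnothing$ (open balls in the ambient metric space); or the Vietoris–Rips complex, whose simplices at scale $\epsilon$ are the nonempty subsets with all pairwise distances less than $\epsilon$. $\mathrm{PH}_0(x_1,\ldots,x_n)$ is the multiset of intervals in the interval decomposition of the reduced $0$-th homology (coefficients in a fixed field) of this filtration, $|I|$ is the length of an interval $I$, and $E_\alpha^0(x_1,\ldots,x_n)=\sum_{I\in\mathrm{PH}_0(x_1,\ldots,x_n)}|I|^\alpha$. (For Vietoris–Rips this equals $\sum_e|e|^\alpha$ over the edges $e$ of a minimum spanning tree on $x_1,\ldots,x_n$.) For $\alpha>0$ and i.i.d. samples $(x_j)$ from $\mu$, $$\dim_{\mathrm{PH}_0^\alpha}(\mu)=\frac{\alpha}{1-\beta},\qquad\beta=\limsup_{n\to\infty}\frac{\log\left(\mathbb{E}\left(E_\alpha^0(x_1,\ldots,x_n)\right)\right)}{\log(n)},$$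 with the conventions $\log 0=-\infty$, $\alpha/(1-\beta)=0$ if $\beta=-\infty$, and $\alpha/(1-\beta)=\infty$ if $\beta=1$. *)

theory Defs
  imports
    "HOL-Probability.Probability"
    "HOL-Library.Poly_Mapping"
    "HOL-Library.Multiset"
    "HOL-Algebra.AbelCoset"
    "HOL-Algebra.Module"
begin

section \<open>Upper box dimension\<close>

definition eln :: "ereal \<Rightarrow> ereal" where
  "eln x = (if x \<le> 0 then -\<infinity> else if x = \<infinity> then \<infinity> else ereal (ln (real_of_ereal x)))"

text \<open>
  The balls are those of the metric space \<open>X\<close>, that is, the traces on \<open>X\<close> of the
  balls of the ambient type. The value is \<open>\<infinity>\<close> if there are arbitrarily large
  families of disjoint balls.
\<close>

definition packing_number :: "real \<Rightarrow> 'a::metric_space set \<Rightarrow> ereal" where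
  "packing_number \<delta> X =
     (SUP C \<in> {C. finite C \<and> C \<subseteq> X \<and> disjoint_family_on (\<lambda>x. ball x \<delta> \<inter> X) C}.
        ereal (real (card C)))"

definition upper_box_dim :: "'a::metric_space set \<Rightarrow> ereal" where
  "upper_box_dim X =
     Limsup (at_right 0) (\<lambda>\<delta>. eln (packing_number \<delta> X) / ereal (- ln \<delta>))"


section \<open>Cech and Vietoris--Rips filtrations\<close>

definition cech :: "'a::metric_space set \<Rightarrow> real \<Rightarrow> 'a set set" where
  "cech S \<epsilon> = {\<sigma>. \<sigma> \<noteq> {} \<and> \<sigma> \<subseteq> S \<and> (\<Inter>y\<in>\<sigma>. ball y \<epsilon>) \<noteq> {}}"

definition rips :: "'a::metric_space set \<Rightarrow> real \<Rightarrow> 'a set set" where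
  "rips S \<epsilon> = {\<sigma>. \<sigma> \<noteq> {} \<and> \<sigma> \<subseteq> S \<and> (\<forall>u\<in>\<sigma>. \<forall>v\<in>\<sigma>. dist u v < \<epsilon>)}"


section \<open>Vector spaces and persistence modules\<close>

text \<open>
  Vector spaces over the field \<open>'k\<close> are \<^type>\<open>module\<close> records whose ring
  multiplication is left unspecified.
\<close>

definition chain_space :: "('b \<Rightarrow>\<^sub>0 'k) set \<Rightarrow> ('k::field, 'b \<Rightarrow>\<^sub>0 'k) module" where
  "chain_space Z = \<lparr>carrier = Z, mult = undefined, one = undefined, zero = 0, add = (+),
     smult = (\<lambda>a. Poly_Mapping.map ((*) a))\<rparr>"

definition quotient_space :: "('k, 'v) module \<Rightarrow> 'v set \<Rightarrow> ('k, 'v set) module" where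
  "quotient_space M B = \<lparr>carrier = a_rcosets\<^bsub>M\<^esub> B, mult = undefined, one = undefined,
     zero = B, add = (<+>\<^bsub>M\<^esub>), smult = (\<lambda>a X. \<Union>x\<in>X. B +>\<^bsub>M\<^esub> (a \<odot>\<^bsub>M\<^esub> x))\<rparr>"

definition linear_iso :: "('k, 'v) module \<Rightarrow> ('k, 'w) module \<Rightarrow> ('v \<Rightarrow> 'w) set" where
  "linear_iso M N = {h \<in> iso (add_monoid M) (add_monoid N).
     \<forall>a. \<forall>x\<in>carrier M. h (a \<odot>\<^bsub>M\<^esub> x) = a \<odot>\<^bsub>N\<^esub> h x}"

text \<open>Persistence modules are indexed by the positive reals.\<close>

record ('k, 'v) persistence_module =
  space_at :: "real \<Rightarrow> ('k, 'v) module"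
  transition :: "real \<Rightarrow> real \<Rightarrow> 'v \<Rightarrow> 'v"

definition pm_isomorphic ::
  "('k, 'v) persistence_module \<Rightarrow> ('k, 'w) persistence_module \<Rightarrow> bool" where
  "pm_isomorphic P Q \<longleftrightarrow> (\<exists>\<phi>.
     (\<forall>t>0. \<phi> t \<in> linear_iso (space_at P t) (space_at Q t)) \<and>
     (\<forall>s t. 0 < s \<longrightarrow> s \<le> t \<longrightarrow> (\<forall>x \<in> carrier (space_at P s).
        \<phi> t (transition P s t x) = transition Q s t (\<phi> s x))))"

text \<open>
  The direct sum of the interval modules of the intervals in the list \<open>Is\<close>: the
  \<open>j\<close>-th summand is \<open>'k\<close> at the scales in \<open>Is ! j\<close> and \<open>0\<close> elsewhere, with identity
  maps between any two scales in \<open>Is ! j\<close>.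
\<close>

definition interval_sum :: "real set list \<Rightarrow> ('k::field, nat \<Rightarrow>\<^sub>0 'k) persistence_module" where
  "interval_sum Is = \<lparr>
     space_at = (\<lambda>t. chain_space {c. Poly_Mapping.keys c \<subseteq> {j. j < length Is \<and> t \<in> Is ! j}}),
     transition = (\<lambda>s t c. \<Sum>j \<in> {j \<in> Poly_Mapping.keys c. t \<in> Is ! j}.
        Poly_Mapping.single j (Poly_Mapping.lookup c j))\<rparr>"

definition interval_decomposition ::
  "('k::field, 'v) persistence_module \<Rightarrow> real set multiset \<Rightarrow> bool" where
  "interval_decomposition P D \<longleftrightarrow>
     (\<forall>I \<in># D. I \<noteq> {} \<and> I \<subseteq> {0<..} \<and> is_interval I) \<and>
     (\<exists>Is. mset Is = D \<and> pm_isomorphic (interval_sum Is) P)"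


section \<open>Reduced homology in degree zero\<close>

text \<open>
  One-chains are combinations of ordered edges \<open>(u, v)\<close>, degenerate ones included.
  They have the same boundaries as the oriented ones, since \<open>(v, u)\<close> has the opposite
  boundary of \<open>(u, v)\<close> and \<open>(u, u)\<close> has boundary \<open>0\<close>.
\<close>

definition boundary1 :: "('a \<times> 'a \<Rightarrow>\<^sub>0 'k::field) \<Rightarrow> 'a \<Rightarrow>\<^sub>0 'k" where
  "boundary1 c = (\<Sum>(u, v) \<in> Poly_Mapping.keys c.
     Poly_Mapping.single v (Poly_Mapping.lookup c (u, v)) -
     Poly_Mapping.single u (Poly_Mapping.lookup c (u, v)))"

definition augmentation :: "('a \<Rightarrow>\<^sub>0 'k::field) \<Rightarrow> 'k" where
  "augmentation c = (\<Sum>v \<in> Poly_Mapping.keys c. Poly_Mapping.lookup c v)"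

definition reduced_cycles0 :: "'a set set \<Rightarrow> ('a \<Rightarrow>\<^sub>0 'k::field) set" where
  "reduced_cycles0 K = {c. Poly_Mapping.keys c \<subseteq> {v. {v} \<in> K} \<and> augmentation c = 0}"

definition boundaries0 :: "'a set set \<Rightarrow> ('a \<Rightarrow>\<^sub>0 'k::field) set" where
  "boundaries0 K = boundary1 ` {c. Poly_Mapping.keys c \<subseteq> {(u, v). {u, v} \<in> K}}"

definition reduced_H0 ::
  "(real \<Rightarrow> 'a set set) \<Rightarrow> ('k::field, ('a \<Rightarrow>\<^sub>0 'k) set) persistence_module" where
  "reduced_H0 K = \<lparr>
     space_at = (\<lambda>t. quotient_space (chain_space (reduced_cycles0 (K t))) (boundaries0 (K t))),
     transition = (\<lambda>s t X.
        \<Union>c\<in>X. boundaries0 (K t) +>\<^bsub>chain_space (reduced_cycles0 (K t))\<^esub> c)\<rparr>"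


section \<open>Persistent homology and its dimension\<close>

text \<open>
  The interval decomposition is unique up to order (Krull--Remak--Schmidt--Azumaya),
  so the choice is immaterial. For the filtrations of a finite point set it exists.
  The argument of type \<open>'k itself\<close> is the field of coefficients.
\<close>

definition PH0 :: "'k::field itself \<Rightarrow> (real \<Rightarrow> 'a set set) \<Rightarrow> real set multiset" where
  "PH0 (_ :: 'k itself) K =
     (SOME D. interval_decomposition
        (reduced_H0 K :: ('k, ('a \<Rightarrow>\<^sub>0 'k) set) persistence_module) D)"

text \<open>
  All intervals of the reduced homology in degree zero are bounded, because the
  complexes of a finite point set are connected at large scales; hence the length
  can be taken in the reals.
\<close>

definition interval_length :: "real set \<Rightarrow> real" where
  "interval_length I = Sup I - Inf I"

definition E0 ::
  "'k::field itself \<Rightarrow> ('a set \<Rightarrow> real \<Rightarrow> 'a set set) \<Rightarrow> real \<Rightarrow> 'a set \<Rightarrow> real" where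
  "E0 k F \<alpha> S = (\<Sum>I \<in># PH0 k (F S). interval_length I powr \<alpha>)"

definition expected_E0 ::
  "'k::field itself \<Rightarrow> ('a set \<Rightarrow> real \<Rightarrow> 'a set set) \<Rightarrow> real \<Rightarrow> 'a measure \<Rightarrow> nat \<Rightarrow> ennreal"
  where
  "expected_E0 k F \<alpha> \<mu> n =
     (\<integral>\<^sup>+ x. ennreal (E0 k F \<alpha> (x ` {..<n})) \<partial>(\<Pi>\<^sub>M j\<in>{..<n}. \<mu>))"

definition growth_exponent ::
  "'k::field itself \<Rightarrow> ('a set \<Rightarrow> real \<Rightarrow> 'a set set) \<Rightarrow> real \<Rightarrow> 'a measure \<Rightarrow> ereal" where
  "growth_exponent k F \<alpha> \<mu> =
     limsup (\<lambda>n. eln (enn2ereal (expected_E0 k F \<alpha> \<mu> n)) / ereal (ln (real n)))"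

definition PH0_dim ::
  "'k::field itself \<Rightarrow> ('a set \<Rightarrow> real \<Rightarrow> 'a set set) \<Rightarrow> real \<Rightarrow> 'a measure \<Rightarrow> ereal" where
  "PH0_dim k F \<alpha> \<mu> =
     (let \<beta> = growth_exponent k F \<alpha> \<mu>
      in if \<beta> = -\<infinity> then 0 else if \<beta> = 1 then \<infinity> else ereal \<alpha> / (1 - \<beta>))"

end

theory Submission
  imports Defs
begin

text \<open>
  The bound holds for every sample, not only in expectation. Let \<open>d\<close> exceed the upper box
  dimension of \<open>X\<close> and let \<open>S\<close> be a finite set of points of \<open>X\<close>. An interval of the reduced
  homology of \<open>S\<close> in degree zero that is alive at scale \<open>t\<close> accounts for one connected
  component of the complex at scale \<open>t\<close>, apart from one component that reduced homology
  does not see. Points in different components have distance at least \<open>t\<close>,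
  so the balls of radius \<open>t / 2\<close> around representatives of the components are disjoint and the
  number of living intervals is bounded by a packing number of \<open>X\<close>, which is \<open>O(t powr - d)\<close>.
  Intervals of length at least \<open>t\<close> are alive at scale \<open>t / 2\<close>. Therefore the \<open>k\<close>-th longest
  interval has length \<open>O(k powr (- 1 / d))\<close>, and summing \<open>k powr (- \<alpha> / d)\<close> over fewer than
  \<open>n\<close> intervals gives \<open>O(n powr (1 - \<alpha> / d))\<close> for \<open>\<alpha> < d\<close> (lemma \<open>E0_le_powr\<close>). So the growth
  exponent is at most \<open>1 - \<alpha> / d\<close>, and letting \<open>d\<close> decrease to the box dimension gives the
  claim.

  The algebraic work is to justify the count of living intervals. The multiset of intervals is
  chosen among all interval decompositions, so it has to be shown that one exists. The elder rule
  provides it (\<open>elder_decomposition\<close>): order the vertices, and let each vertex but the first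
  give one interval, which ends when the vertex becomes connected to an earlier one. The chosen
  decomposition is then compared with this one. At each scale it has no more
  living intervals than the elder one, by invariance of dimension (\<open>interval_sum_card_le\<close>). Moreover the
  intervals of the chosen one are closed under passing to smaller positive scales, because the
  transition maps are surjective (\<open>interval_sum_downward_closed\<close>). Both facts enter
  \<open>PH0_counting\<close>, from which the rest of the proof is metric and analytic.
\<close>

section \<open>Chains and linear combinations\<close>

abbreviation scl :: "'k::field \<Rightarrow> ('b \<Rightarrow>\<^sub>0 'k) \<Rightarrow> 'b \<Rightarrow>\<^sub>0 'k" where
  "scl a \<equiv> Poly_Mapping.map ((*) a)"

lemma lookup_scl [simp]: "Poly_Mapping.lookup (scl a c) j = a * Poly_Mapping.lookup c j"
  by (simp add: Poly_Mapping.map.rep_eq when_def)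

interpretation chains: vector_space "scl :: 'k::field \<Rightarrow> ('b \<Rightarrow>\<^sub>0 'k) \<Rightarrow> 'b \<Rightarrow>\<^sub>0 'k"
  by unfold_locales (auto intro!: poly_mapping_eqI simp: lookup_add algebra_simps)

lemma scl_single [simp]: "scl a (Poly_Mapping.single j b) = Poly_Mapping.single j (a * b)"
  by (rule poly_mapping_eqI) (simp add: lookup_single when_def)

lemma single_sum:
  "Poly_Mapping.single x (\<Sum>i\<in>T. a i) = (\<Sum>i\<in>T. Poly_Mapping.single x (a i))"
  by (induction T rule: infinite_finite_induct) (auto simp: single_add)

definition supported :: "'b set \<Rightarrow> ('b \<Rightarrow>\<^sub>0 'k::field) set" where
  "supported J = {c. Poly_Mapping.keys c \<subseteq> J}"

lemma mem_supported: "c \<in> supported J \<longleftrightarrow> (\<forall>j. j \<notin> J \<longrightarrow> Poly_Mapping.lookup c j = 0)"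
  by (auto simp: supported_def in_keys_iff)

lemma subspace_supported: "chains.subspace (supported J)"
  by (auto simp: chains.subspace_def mem_supported lookup_add)

lemma single_in_supported: "j \<in> J \<Longrightarrow> Poly_Mapping.single j a \<in> supported J"
  by (auto simp: mem_supported lookup_single when_def)

text \<open>
  Both linear maps given explicitly below, the boundary map and the one that realises
  the interval decomposition, are of the form \<open>lincomb v\<close>, which sends the \<open>j\<close>-th basis vector to \<open>v j\<close>.
  Likewise \<open>pairing f\<close> is the functional with the values \<open>f\<close> on the basis.
\<close>

definition lincomb :: "('b \<Rightarrow> 'c \<Rightarrow>\<^sub>0 'k) \<Rightarrow> ('b \<Rightarrow>\<^sub>0 'k::field) \<Rightarrow> 'c \<Rightarrow>\<^sub>0 'k" where
  "lincomb v c = (\<Sum>j\<in>Poly_Mapping.keys c. scl (Poly_Mapping.lookup c j) (v j))"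

definition pairing :: "('b \<Rightarrow> 'k) \<Rightarrow> ('b \<Rightarrow>\<^sub>0 'k::field) \<Rightarrow> 'k" where
  "pairing f c = (\<Sum>j\<in>Poly_Mapping.keys c. Poly_Mapping.lookup c j * f j)"

lemma lincomb_superset:
  "finite T \<Longrightarrow> Poly_Mapping.keys c \<subseteq> T \<Longrightarrow>
   lincomb v c = (\<Sum>j\<in>T. scl (Poly_Mapping.lookup c j) (v j))"
  unfolding lincomb_def by (rule sum.mono_neutral_left) (auto simp: in_keys_iff)

lemma pairing_superset:
  "finite T \<Longrightarrow> Poly_Mapping.keys c \<subseteq> T \<Longrightarrow>
   pairing f c = (\<Sum>j\<in>T. Poly_Mapping.lookup c j * f j)"
  unfolding pairing_def by (rule sum.mono_neutral_left) (auto simp: in_keys_iff)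

lemma lincomb_add: "lincomb v (c + d) = lincomb v c + lincomb v d"
proof -
  let ?T = "Poly_Mapping.keys c \<union> Poly_Mapping.keys d"
  have "lincomb v (c + d) = (\<Sum>j\<in>?T. scl (Poly_Mapping.lookup (c + d) j) (v j))"
    by (rule lincomb_superset) (auto dest: keys_add[THEN subsetD])
  also have "\<dots> = (\<Sum>j\<in>?T. scl (Poly_Mapping.lookup c j) (v j)) +
      (\<Sum>j\<in>?T. scl (Poly_Mapping.lookup d j) (v j))"
    by (simp add: lookup_add chains.scale_left_distrib sum.distrib)
  finally show ?thesis
    by (simp add: lincomb_superset[of ?T c] lincomb_superset[of ?T d])
qed

lemma lincomb_scl: "lincomb v (scl a c) = scl a (lincomb v c)"
proof -
  have "lincomb v (scl a c) =
      (\<Sum>j\<in>Poly_Mapping.keys c. scl (Poly_Mapping.lookup (scl a c) j) (v j))"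
    by (rule lincomb_superset) (auto simp: in_keys_iff)
  then show ?thesis
    by (simp add: lincomb_def chains.scale_sum_right)
qed

lemma lincomb_diff: "lincomb v (c - d) = lincomb v c - lincomb v d"
  using lincomb_add[of v "c - d" d] by simp

lemma lincomb_zero [simp]: "lincomb v 0 = 0"
  by (simp add: lincomb_def)

lemma lincomb_single [simp]: "lincomb v (Poly_Mapping.single j a) = scl a (v j)"
  by (simp add: lincomb_def)

lemma lincomb_in_subspace:
  assumes "chains.subspace V" "\<And>j. j \<in> Poly_Mapping.keys c \<Longrightarrow> v j \<in> V"
  shows "lincomb v c \<in> V"
  unfolding lincomb_def using assms by (intro chains.subspace_sum chains.subspace_scale) auto

lemma lincomb_single_self: "lincomb (\<lambda>j. Poly_Mapping.single j 1) c = c"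
proof -
  have "Poly_Mapping.lookup (lincomb (\<lambda>j. Poly_Mapping.single j 1) c) i = Poly_Mapping.lookup c i" for i
  proof -
    have "Poly_Mapping.lookup (lincomb (\<lambda>j. Poly_Mapping.single j 1) c) i =
      (\<Sum>j\<in>Poly_Mapping.keys c. if j = i then Poly_Mapping.lookup c j else 0)"
      by (simp add: lincomb_def lookup_sum lookup_single when_def)
    also have "\<dots> = Poly_Mapping.lookup c i"
      by (simp add: in_keys_iff)
    finally show ?thesis .
  qed
  then show ?thesis by (rule poly_mapping_eqI)
qed

lemma pairing_add: "pairing f (c + d) = pairing f c + pairing f d"
proof -
  let ?T = "Poly_Mapping.keys c \<union> Poly_Mapping.keys d"
  have "pairing f (c + d) = (\<Sum>j\<in>?T. Poly_Mapping.lookup (c + d) j * f j)"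
    by (rule pairing_superset) (auto dest: keys_add[THEN subsetD])
  also have "\<dots> = (\<Sum>j\<in>?T. Poly_Mapping.lookup c j * f j) +
      (\<Sum>j\<in>?T. Poly_Mapping.lookup d j * f j)"
    by (simp add: lookup_add distrib_right sum.distrib)
  finally show ?thesis
    by (simp add: pairing_superset[of ?T c] pairing_superset[of ?T d])
qed

lemma pairing_scl: "pairing f (scl a c) = a * pairing f c"
proof -
  have "pairing f (scl a c) =
      (\<Sum>j\<in>Poly_Mapping.keys c. Poly_Mapping.lookup (scl a c) j * f j)"
    by (rule pairing_superset) (auto simp: in_keys_iff)
  then show ?thesis
    by (simp add: pairing_def sum_distrib_left mult.assoc)
qed

lemma pairing_diff: "pairing f (c - d) = pairing f c - pairing f d"
  using pairing_add[of f "c - d" d] by simp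

lemma pairing_sum: "pairing f (\<Sum>i\<in>T. c i) = (\<Sum>i\<in>T. pairing f (c i))"
  by (induction T rule: infinite_finite_induct) (auto simp: pairing_add, auto simp: pairing_def)

lemma pairing_single [simp]: "pairing f (Poly_Mapping.single j a) = a * f j"
  by (simp add: pairing_def)

lemma pairing_lincomb:
  "pairing f (lincomb v c) = (\<Sum>j\<in>Poly_Mapping.keys c. Poly_Mapping.lookup c j * pairing f (v j))"
  by (simp add: lincomb_def pairing_sum pairing_scl)

section \<open>Quotients of chain spaces\<close>

lemma subspace_closed:
  assumes "chains.subspace Z"
  shows "x \<in> Z \<Longrightarrow> y \<in> Z \<Longrightarrow> x + y \<in> Z" "x \<in> Z \<Longrightarrow> scl a x \<in> Z" "0 \<in> Z"
    "x \<in> Z \<Longrightarrow> y \<in> Z \<Longrightarrow> x - y \<in> Z" "x \<in> Z \<Longrightarrow> - x \<in> Z"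
  using assms chains.subspace_diff[of Z] chains.subspace_neg[of Z] by (auto simp: chains.subspace_def)

definition coset :: "('a \<Rightarrow>\<^sub>0 'k::field) set \<Rightarrow> ('a \<Rightarrow>\<^sub>0 'k) \<Rightarrow> ('a \<Rightarrow>\<^sub>0 'k) set" where
  "coset B z = {x. x - z \<in> B}"

lemma carrier_chain_space [simp]: "carrier (chain_space Z) = Z"
  by (simp add: chain_space_def)

lemma chain_space_coset: "B +>\<^bsub>chain_space Z\<^esub> z = coset B z"
  by (force simp: a_r_coset_def r_coset_def chain_space_def coset_def)

lemma coset_eq_iff:
  assumes "chains.subspace B"
  shows "coset B x = coset B y \<longleftrightarrow> x - y \<in> B"
proof
  assume "coset B x = coset B y"
  moreover have "x \<in> coset B x" using assms by (simp add: coset_def subspace_closed)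
  ultimately show "x - y \<in> B" by (simp add: coset_def)
next
  assume *: "x - y \<in> B"
  have "z - x \<in> B \<longleftrightarrow> z - y \<in> B" for z
    using subspace_closed(1)[OF assms *, of "z - x"] subspace_closed(4)[OF assms _ *, of "z - y"]
    by (auto simp: algebra_simps)
  then show "coset B x = coset B y" by (simp add: coset_def)
qed

lemma coset_add:
  assumes "chains.subspace B"
  shows "coset B x <+>\<^bsub>chain_space Z\<^esub> coset B y = coset B (x + y)"
proof -
  have sum: "coset B x <+>\<^bsub>chain_space Z\<^esub> coset B y = {u + v |u v. u \<in> coset B x \<and> v \<in> coset B y}"
    by (auto simp: set_add_def set_mult_def chain_space_def)
  have "z \<in> coset B x <+>\<^bsub>chain_space Z\<^esub> coset B y" if "z - (x + y) \<in> B" for z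
  proof -
    have "z = x + (z - x)" "x \<in> coset B x" "z - x \<in> coset B y"
      using that subspace_closed[OF assms] by (auto simp: coset_def algebra_simps)
    then show ?thesis unfolding sum by blast
  qed
  moreover have "z - (x + y) \<in> B" if z: "z \<in> coset B x <+>\<^bsub>chain_space Z\<^esub> coset B y" for z
  proof -
    obtain u v where "z = u + v" "u - x \<in> B" "v - y \<in> B"
      using z unfolding sum by (auto simp: coset_def)
    then show ?thesis
      using subspace_closed(1)[OF assms, of "u - x" "v - y"] by (simp add: algebra_simps)
  qed
  ultimately show ?thesis by (auto simp: coset_def[of B "x + y"])
qed

text \<open>
  The maps between quotients are defined by a union over a coset, which avoids choosing
  a representative. A map that carries \<open>B\<close> into \<open>B'\<close> sends all representatives of a coset
  to the same coset, so that the union is this coset.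
\<close>

lemma Union_coset:
  assumes "chains.subspace B" "chains.subspace B'"
    and "\<And>b. b \<in> B \<Longrightarrow> f b \<in> B'" "\<And>x y. f (x - y) = f x - f y"
  shows "(\<Union>x\<in>coset B z. coset B' (f x)) = coset B' (f z)"
proof -
  have "coset B' (f x) = coset B' (f z)" if "x \<in> coset B z" for x
    using that assms by (metis coset_def coset_eq_iff mem_Collect_eq)
  moreover have "z \<in> coset B z" using assms by (simp add: coset_def subspace_closed)
  ultimately show ?thesis by blast
qed

lemma quotient_linear_iso:
  assumes V: "chains.subspace V" and B: "chains.subspace B"
    and into: "\<And>c. c \<in> V \<Longrightarrow> lincomb v c \<in> Z"
    and inj: "\<And>c. c \<in> V \<Longrightarrow> lincomb v c \<in> B \<Longrightarrow> c = 0"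
    and surj: "\<And>z. z \<in> Z \<Longrightarrow> \<exists>c\<in>V. z - lincomb v c \<in> B"
  shows "(\<lambda>c. coset B (lincomb v c)) \<in> linear_iso (chain_space V) (quotient_space (chain_space Z) B)"
proof -
  have car: "carrier (quotient_space (chain_space Z) B) = coset B ` Z"
  proof -
    have "carrier (quotient_space (chain_space Z) B) =
        (\<lambda>z. B +>\<^bsub>chain_space Z\<^esub> z) ` carrier (chain_space Z)"
      by (auto simp: quotient_space_def A_RCOSETS_def RCOSETS_def a_r_coset_def)
    also have "\<dots> = coset B ` Z"
      by (simp only: chain_space_coset) (simp add: chain_space_def)
    finally show ?thesis .
  qed
  have "inj_on (\<lambda>c. coset B (lincomb v c)) V"
  proof (rule inj_onI)
    fix c d assume "c \<in> V" "d \<in> V" "coset B (lincomb v c) = coset B (lincomb v d)"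
    then have "lincomb v (c - d) \<in> B" using B by (simp add: coset_eq_iff lincomb_diff)
    then have "c - d = 0" using inj \<open>c \<in> V\<close> \<open>d \<in> V\<close> subspace_closed(4)[OF V] by blast
    then show "c = d" by simp
  qed
  moreover have "(\<lambda>c. coset B (lincomb v c)) ` V = coset B ` Z"
  proof
    show "coset B ` Z \<subseteq> (\<lambda>c. coset B (lincomb v c)) ` V"
      using surj B by (force simp: coset_eq_iff)
  qed (use into in auto)
  ultimately have "bij_betw (\<lambda>c. coset B (lincomb v c)) V (coset B ` Z)"
    by (simp add: bij_betw_def)
  moreover have "coset B (lincomb v (scl a c)) =
     (\<Union>x\<in>coset B (lincomb v c). B +>\<^bsub>chain_space Z\<^esub> scl a x)" for a c
  proof -
    have "(\<Union>x\<in>coset B (lincomb v c). coset B (scl a x)) = coset B (scl a (lincomb v c))"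
      using B by (intro Union_coset) (auto simp: subspace_closed chains.scale_right_diff_distrib)
    then show ?thesis by (simp add: chain_space_coset lincomb_scl)
  qed
  ultimately show ?thesis
    using into
    unfolding linear_iso_def iso_def hom_def mem_Collect_eq
    by (auto simp: car)
      (auto simp: chain_space_def quotient_space_def lincomb_add
       coset_add[OF B, where Z = Z, unfolded chain_space_def, symmetric])
qed

section \<open>Reduced homology in degree zero\<close>

lemma boundary1_eq_lincomb:
  "boundary1 = lincomb (\<lambda>(u, v). Poly_Mapping.single v 1 - Poly_Mapping.single u 1)"
  by (auto simp: fun_eq_iff boundary1_def lincomb_def chains.scale_right_diff_distrib intro!: sum.cong)

lemma augmentation_eq_pairing: "augmentation = pairing (\<lambda>_. 1)"
  by (auto simp: fun_eq_iff augmentation_def pairing_def)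

lemma subspace_boundaries0: "chains.subspace (boundaries0 K :: ('a \<Rightarrow>\<^sub>0 'k::field) set)"
proof -
  let ?E = "supported {(u, v). {u, v} \<in> K} :: ('a \<times> 'a \<Rightarrow>\<^sub>0 'k) set"
  have B: "boundaries0 K = boundary1 ` ?E"
    by (simp add: boundaries0_def supported_def)
  note E = subspace_closed[OF subspace_supported[of "{(u, v). {u, v} \<in> K}"]]
  show ?thesis
    unfolding chains.subspace_def B
  proof (intro conjI ballI allI)
    show "0 \<in> boundary1 ` ?E"
      by (rule image_eqI[of _ _ 0]) (simp_all add: boundary1_eq_lincomb E)
  next
    fix x y assume "x \<in> boundary1 ` ?E" "y \<in> boundary1 ` ?E"
    then show "x + y \<in> boundary1 ` ?E"
      by (auto simp: boundary1_eq_lincomb E lincomb_add[symmetric])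
  next
    fix a x assume "x \<in> boundary1 ` ?E"
    then show "scl a x \<in> boundary1 ` ?E"
      by (auto simp: boundary1_eq_lincomb E lincomb_scl[symmetric])
  qed
qed

lemma boundaries0_mono: "K \<subseteq> L \<Longrightarrow> boundaries0 K \<subseteq> boundaries0 L"
  by (fastforce simp: boundaries0_def)

text \<open>
  Two vertices are homologous if and only if an edge path joins them. Taking homology as
  the definition makes the relation an equivalence by the subspace laws alone, without
  any reasoning about paths.
\<close>

definition homologous :: "'k::field itself \<Rightarrow> 'a set set \<Rightarrow> 'a \<Rightarrow> 'a \<Rightarrow> bool" where
  "homologous (_ :: 'k itself) K u v \<longleftrightarrow>
     Poly_Mapping.single u 1 - Poly_Mapping.single v 1 \<in> (boundaries0 K :: ('a \<Rightarrow>\<^sub>0 'k) set)"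

lemma homologous_sym: "homologous k K u v \<Longrightarrow> homologous k K v u"
  using subspace_closed(5)[OF subspace_boundaries0] by (fastforce simp: homologous_def)

lemma homologous_trans: "homologous k K u v \<Longrightarrow> homologous k K v w \<Longrightarrow> homologous k K u w"
  using subspace_closed(1)[OF subspace_boundaries0] by (fastforce simp: homologous_def)

lemma homologous_mono: "K \<subseteq> L \<Longrightarrow> homologous k K u v \<Longrightarrow> homologous k L u v"
  using boundaries0_mono[of K L] by (auto simp: homologous_def)

lemma homologous_edge:
  assumes "{u, v} \<in> K"
  shows "homologous (k :: 'k::field itself) K u v"
proof -
  have "Poly_Mapping.single u 1 - Poly_Mapping.single v (1 :: 'k) =
      boundary1 (Poly_Mapping.single (v, u) 1)"
    by (simp add: boundary1_eq_lincomb)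
  then show ?thesis
    using assms unfolding homologous_def boundaries0_def
    by (auto simp: insert_commute)
qed

text \<open>
  A function on the vertices that is constant along edges is a cocycle, and so it
  annihilates boundaries. Applied to indicator functions, this is how non-homologous
  vertices are told apart.
\<close>

lemma pairing_boundary:
  assumes f: "\<And>u v. {u, v} \<in> K \<Longrightarrow> f u = f v" and b: "b \<in> boundaries0 K"
  shows "pairing f b = 0"
proof -
  obtain c where c: "b = boundary1 c" "Poly_Mapping.keys c \<subseteq> {(u, v). {u, v} \<in> K}"
    using b by (auto simp: boundaries0_def)
  show ?thesis
    unfolding c(1) boundary1_eq_lincomb pairing_lincomb
    using c(2) f by (intro sum.neutral) (auto simp: pairing_diff)
qed

lemma subspace_reduced_cycles0: "chains.subspace (reduced_cycles0 K)"
proof -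
  have "reduced_cycles0 K = supported {v. {v} \<in> K} \<inter> {c. pairing (\<lambda>_. 1) c = 0}"
    by (auto simp: reduced_cycles0_def supported_def augmentation_eq_pairing)
  moreover have "chains.subspace {c. pairing (\<lambda>_. 1) c = 0}"
    by (auto simp: chains.subspace_def pairing_add pairing_scl) (simp add: pairing_def)
  ultimately show ?thesis
    using chains.subspace_inter[OF subspace_supported] by metis
qed

section \<open>The elder rule\<close>

text \<open>
  The vertices are listed by age. Every vertex but the first gives one class, and
  \<open>elder_interval k K xs i\<close> is the life span of the class of \<open>xs ! Suc i\<close>: it dies when
  the vertex becomes connected to an older one. The index is shifted by one because the
  oldest vertex gives no class in reduced homology.
\<close>

definition elder_interval ::
  "'k::field itself \<Rightarrow> (real \<Rightarrow> 'a set set) \<Rightarrow> 'a list \<Rightarrow> nat \<Rightarrow> real set" where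
  "elder_interval k K xs i = {t. 0 < t \<and> (\<forall>j\<le>i. \<not> homologous k (K t) (xs ! Suc i) (xs ! j))}"

lemma space_at_interval_sum:
  "space_at (interval_sum Is) t =
     chain_space (supported {j. j < length Is \<and> t \<in> Is ! j})"
  by (simp add: interval_sum_def supported_def)

text \<open>
  At each scale at which \<open>xs ! Suc i\<close> is dead it is homologous to some older vertex, and one
  older vertex serves for all of these scales: otherwise each of the finitely many
  candidates would fail at some dead scale, yet by monotonicity a candidate that works at
  the least of these scales works at all of them.
\<close>

lemma elder_parent:
  fixes k :: "'k::field itself"
  assumes mono: "\<And>s t. 0 < s \<Longrightarrow> s \<le> t \<Longrightarrow> K s \<subseteq> K t"
  shows "\<exists>p\<le>i. \<forall>t>0. t \<notin> elder_interval k K xs i \<longrightarrow> homologous k (K t) (xs ! Suc i) (xs ! p)"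
proof (rule ccontr)
  assume "\<not> ?thesis"
  then obtain f where f: "\<And>p. p \<le> i \<Longrightarrow> 0 < f p \<and> f p \<notin> elder_interval k K xs i \<and>
      \<not> homologous k (K (f p)) (xs ! Suc i) (xs ! p)"
    by metis
  define t where "t = Min (f ` {..i})"
  have "t \<in> f ` {..i}" unfolding t_def by (rule Min_in) auto
  then have "0 < t" "t \<notin> elder_interval k K xs i" using f by auto
  then obtain p where p: "p \<le> i" "homologous k (K t) (xs ! Suc i) (xs ! p)"
    by (auto simp: elder_interval_def)
  have "t \<le> f p" unfolding t_def using p(1) by (intro Min_le) auto
  then have "homologous k (K (f p)) (xs ! Suc i) (xs ! p)"
    using homologous_mono[OF mono[OF \<open>0 < t\<close> \<open>t \<le> f p\<close>] p(2)] by simp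
  then show False using f p(1) by blast
qed

text \<open>
  With \<open>p i\<close> the index of that older vertex, the cycles \<open>xs ! Suc i - xs ! p i\<close> do not depend
  on the scale. At scale \<open>t\<close> those that are dead are boundaries, and the classes of the
  others form a basis. They are independent because the youngest vertex in a vanishing
  combination is not connected to any older one, so that the indicator function of its
  component isolates its coefficient. They span because, by going from each vertex to its
  older partner repeatedly, every difference \<open>xs ! i - xs ! 0\<close> is reduced to them.
  Since the cycles are the same at all scales, these bases are compatible with the
  transition maps.
\<close>

theorem elder_decomposition:
  fixes K :: "real \<Rightarrow> 'a set set" and k :: "'k::field itself"
  assumes xs: "xs \<noteq> []"
    and vertices: "\<And>t. 0 < t \<Longrightarrow> {v. {v} \<in> K t} = set xs"
    and mono: "\<And>s t. 0 < s \<Longrightarrow> s \<le> t \<Longrightarrow> K s \<subseteq> K t"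
  shows "pm_isomorphic (interval_sum (map (elder_interval k K xs) [0..<length xs - 1]))
    (reduced_H0 K :: ('k, ('a \<Rightarrow>\<^sub>0 'k) set) persistence_module)"
proof -
  let ?one = "\<lambda>x. Poly_Mapping.single x (1 :: 'k)"
  define n where "n = length xs - 1"
  have len: "length xs = Suc n" using xs by (cases xs) (auto simp: n_def)
  let ?Is = "map (elder_interval k K xs) [0..<n]"
  have "\<forall>i. \<exists>p\<le>i. \<forall>t>0. t \<notin> elder_interval k K xs i \<longrightarrow>
      homologous k (K t) (xs ! Suc i) (xs ! p)"
    by (intro allI elder_parent mono)
  then obtain p where p: "\<And>i. p i \<le> i"
    "\<And>i t. 0 < t \<Longrightarrow> t \<notin> elder_interval k K xs i \<Longrightarrow> homologous k (K t) (xs ! Suc i) (xs ! p i)"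
    unfolding choice_iff by blast
  define v where "v i = ?one (xs ! Suc i) - ?one (xs ! p i)" for i
  define J where "J t = {j. j < n \<and> t \<in> elder_interval k K xs j}" for t
  define \<phi> where "\<phi> t = (\<lambda>c. coset (boundaries0 (K t)) (lincomb v c))" for t
  let ?Z = "\<lambda>t. reduced_cycles0 (K t) :: ('a \<Rightarrow>\<^sub>0 'k) set"
  let ?B = "\<lambda>t. boundaries0 (K t) :: ('a \<Rightarrow>\<^sub>0 'k) set"
  have J: "{j. j < length ?Is \<and> t \<in> ?Is ! j} = J t" for t
    by (auto simp: J_def)
  have dead: "v i \<in> ?B t" if "0 < t" "t \<notin> elder_interval k K xs i" for i t
    using p(2)[OF that] by (simp add: v_def homologous_def)
  have iso: "\<phi> t \<in> linear_iso (chain_space (supported (J t))) (quotient_space (chain_space (?Z t)) (?B t))"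
    if t: "0 < t" for t
    unfolding \<phi>_def
  proof (rule quotient_linear_iso[OF subspace_supported subspace_boundaries0])
    fix c :: "nat \<Rightarrow>\<^sub>0 'k" assume c: "c \<in> supported (J t)"
    show "lincomb v c \<in> ?Z t"
    proof (rule lincomb_in_subspace[OF subspace_reduced_cycles0])
      fix j assume "j \<in> Poly_Mapping.keys c"
      then have "j < n" using c by (auto simp: supported_def J_def)
      then have "xs ! Suc j \<in> set xs" "xs ! p j \<in> set xs"
        using p(1)[of j] by (auto simp: len intro!: nth_mem)
      then have "v j \<in> supported {v. {v} \<in> K t}"
        unfolding v_def vertices[OF t]
        by (intro subspace_closed(4)[OF subspace_supported] single_in_supported)
      then show "v j \<in> ?Z t"
        by (simp add: reduced_cycles0_def supported_def augmentation_eq_pairing v_def pairing_diff)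
    qed
    assume B: "lincomb v c \<in> ?B t"
    show "c = 0"
    proof (rule ccontr)
      assume "c \<noteq> 0"
      define m where "m = Max (Poly_Mapping.keys c)"
      have m: "m \<in> Poly_Mapping.keys c" unfolding m_def using \<open>c \<noteq> 0\<close> by (intro Max_in) auto
      have le: "j \<le> m" if "j \<in> Poly_Mapping.keys c" for j
        unfolding m_def using that by simp
      have mJ: "t \<in> elder_interval k K xs m" using m c by (auto simp: supported_def J_def)
      \<comment> \<open>The indicator function of the component of the youngest vertex that occurs.\<close>
      define f where "f x = (if homologous k (K t) (xs ! Suc m) x then 1 else 0 :: 'k)" for x
      have old: "f (xs ! j) = 0" if "j \<le> m" for j
        using mJ that by (auto simp: f_def elder_interval_def)
      have self: "f (xs ! Suc m) = 1"
        by (simp add: f_def homologous_def subspace_closed(3)[OF subspace_boundaries0])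
      have "0 = pairing f (lincomb v c)"
      proof (rule pairing_boundary[OF _ B, symmetric])
        fix x y assume "{x, y} \<in> K t"
        then have "homologous k (K t) x y" by (rule homologous_edge)
        then show "f x = f y"
          unfolding f_def by (meson homologous_sym homologous_trans)
      qed
      also have "\<dots> = (\<Sum>j\<in>Poly_Mapping.keys c. if j = m then Poly_Mapping.lookup c m else 0)"
        unfolding pairing_lincomb
      proof (rule sum.cong[OF refl])
        fix j assume j: "j \<in> Poly_Mapping.keys c"
        show "Poly_Mapping.lookup c j * pairing f (v j) = (if j = m then Poly_Mapping.lookup c m else 0)"
          using le[OF j] old[of "Suc j"] old[of "p j"] p(1)[of j] self
          by (auto simp: v_def pairing_diff)
      qed
      also have "\<dots> = Poly_Mapping.lookup c m" using m by simp
      finally show False using m by (simp add: in_keys_iff)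
    qed
  next
    fix z assume z: "z \<in> ?Z t"
    \<comment> \<open>The chains that are homologous to a combination of living classes.\<close>
    define W where "W = {x. \<exists>c\<in>supported (J t). x - lincomb v c \<in> ?B t}"
    have W: "chains.subspace W"
    proof -
      have "0 \<in> W" unfolding W_def
        by (auto intro!: bexI[of _ 0] simp: subspace_closed(3)[OF subspace_boundaries0] subspace_closed(3)[OF subspace_supported])
      moreover have "x + y \<in> W" if xy: "x \<in> W" "y \<in> W" for x y
      proof -
        obtain c d where "c \<in> supported (J t)" "d \<in> supported (J t)"
          "x - lincomb v c \<in> ?B t" "y - lincomb v d \<in> ?B t" using xy by (auto simp: W_def)
        then have "c + d \<in> supported (J t)" "(x + y) - lincomb v (c + d) \<in> ?B t"
          using subspace_closed(1)[OF subspace_boundaries0, of "x - lincomb v c" "K t" "y - lincomb v d"]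
          by (auto simp: subspace_closed(1)[OF subspace_supported] lincomb_add algebra_simps)
        then show ?thesis by (auto simp: W_def)
      qed
      moreover have "scl a x \<in> W" if x: "x \<in> W" for a x
      proof -
        obtain c where "c \<in> supported (J t)" "x - lincomb v c \<in> ?B t"
          using x by (auto simp: W_def)
        then have "scl a c \<in> supported (J t)" "scl a x - lincomb v (scl a c) \<in> ?B t"
          using subspace_closed(2)[OF subspace_boundaries0, of "x - lincomb v c" "K t" a]
          by (auto simp: subspace_closed(2)[OF subspace_supported] lincomb_scl
              chains.scale_right_diff_distrib)
        then show ?thesis by (auto simp: W_def)
      qed
      ultimately show ?thesis by (auto simp: chains.subspace_def)
    qed
    have BW: "b \<in> W" if "b \<in> ?B t" for b
      unfolding W_def using that subspace_closed(3)[OF subspace_supported]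
      by (auto intro!: bexI[of _ 0])
    have vW: "v i \<in> W" if "i < n" for i
    proof (cases "t \<in> elder_interval k K xs i")
      case True
      then have "i \<in> J t" using that by (simp add: J_def)
      then have "?one i \<in> supported (J t)" "v i - lincomb v (?one i) \<in> ?B t"
        by (auto simp: single_in_supported subspace_closed(3)[OF subspace_boundaries0])
      then show ?thesis unfolding W_def mem_Collect_eq by (rule bexI[rotated])
    qed (use dead t BW in auto)
    have to_root: "?one (xs ! i) - ?one (xs ! 0) \<in> W" if "i \<le> n" for i
      using that
    proof (induction i rule: less_induct)
      case (less i)
      show ?case
      proof (cases i)
        case 0
        then show ?thesis using subspace_closed(3)[OF W] by simp
      next
        case (Suc j)
        have "v j + (?one (xs ! p j) - ?one (xs ! 0)) \<in> W"
          using less Suc p(1)[of j] by (intro subspace_closed(1)[OF W] vW) auto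
        then show ?thesis by (simp add: v_def Suc)
      qed
    qed
    \<comment> \<open>A chain with zero augmentation is a combination of differences from the oldest vertex.\<close>
    have "lincomb (\<lambda>x. ?one x - ?one (xs ! 0)) z =
        lincomb ?one z - scl (pairing (\<lambda>_. 1) z) (?one (xs ! 0))"
      by (simp add: lincomb_def pairing_def chains.scale_right_diff_distrib sum_subtractf
          flip: single_sum)
    also have "\<dots> = z"
      using z by (simp add: reduced_cycles0_def augmentation_eq_pairing lincomb_single_self)
    finally have "z = lincomb (\<lambda>x. ?one x - ?one (xs ! 0)) z" by (rule sym)
    also have "\<dots> \<in> W"
    proof (rule lincomb_in_subspace[OF W])
      fix x assume "x \<in> Poly_Mapping.keys z"
      then have "x \<in> set xs" using z vertices[OF t] by (auto simp: reduced_cycles0_def)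
      then show "?one x - ?one (xs ! 0) \<in> W"
        using to_root by (auto simp: in_set_conv_nth len)
    qed
    finally show "\<exists>c\<in>supported (J t). z - lincomb v c \<in> ?B t" by (simp add: W_def)
  qed
  have natural: "\<phi> t (transition (interval_sum ?Is) s t c) =
      transition (reduced_H0 K :: ('k, ('a \<Rightarrow>\<^sub>0 'k) set) persistence_module) s t (\<phi> s c)"
    if st: "0 < s" "s \<le> t" and c: "c \<in> supported (J s)" for s t c
  proof -
    have t: "0 < t" using st by simp
    let ?r = "transition (interval_sum ?Is) s t c"
    let ?keep = "{j \<in> Poly_Mapping.keys c. t \<in> ?Is ! j}"
    have r: "?r = (\<Sum>j\<in>?keep. Poly_Mapping.single j (Poly_Mapping.lookup c j))"
      by (simp add: interval_sum_def)
    have look: "Poly_Mapping.lookup ?r j = (if j \<in> ?keep then Poly_Mapping.lookup c j else 0)" for j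
      unfolding r by (simp add: lookup_sum lookup_single when_def)
    have "lincomb v (c - ?r) \<in> ?B t"
    proof (rule lincomb_in_subspace[OF subspace_boundaries0])
      fix j assume j: "j \<in> Poly_Mapping.keys (c - ?r)"
      then have "Poly_Mapping.lookup c j \<noteq> Poly_Mapping.lookup ?r j"
        by (simp add: in_keys_iff lookup_minus)
      then have "j \<in> Poly_Mapping.keys c" "t \<notin> ?Is ! j"
        by (auto simp: look in_keys_iff split: if_splits)
      moreover then have "j < n" using c by (auto simp: supported_def J_def)
      ultimately show "v j \<in> ?B t" using dead[OF t] by auto
    qed
    then have "coset (?B t) (lincomb v c) = coset (?B t) (lincomb v ?r)"
      by (simp add: coset_eq_iff subspace_boundaries0 lincomb_diff)
    moreover have "(\<Union>x\<in>coset (?B s) (lincomb v c). coset (?B t) x) = coset (?B t) (lincomb v c)"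
      using boundaries0_mono[OF mono[OF st]]
      by (intro Union_coset[where f = "\<lambda>x. x"] subspace_boundaries0) auto
    ultimately show ?thesis
      by (simp add: \<phi>_def reduced_H0_def chain_space_coset)
  qed
  show ?thesis
    unfolding pm_isomorphic_def n_def[symmetric]
  proof (intro exI[of _ \<phi>] conjI allI impI ballI)
    fix t :: real assume "0 < t"
    then show "\<phi> t \<in> linear_iso (space_at (interval_sum ?Is) t) (space_at (reduced_H0 K) t)"
      unfolding space_at_interval_sum J using iso by (simp add: reduced_H0_def)
  next
    fix s t :: real and c :: "nat \<Rightarrow>\<^sub>0 'k"
    assume st: "0 < s" "s \<le> t" and c: "c \<in> carrier (space_at (interval_sum ?Is) s)"
    have "c \<in> supported (J s)"
      using c unfolding space_at_interval_sum J by (simp add: chain_space_def)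
    then show "\<phi> t (transition (interval_sum ?Is) s t c) = transition (reduced_H0 K) s t (\<phi> s c)"
      by (rule natural[OF st])
  qed
qed

section \<open>Isomorphic sums of intervals\<close>

lemma linear_iso_chain_spaceD:
  assumes "h \<in> linear_iso (chain_space V) (chain_space W)"
  shows "bij_betw h V W"
    and "\<And>x y. x \<in> V \<Longrightarrow> y \<in> V \<Longrightarrow> h (x + y) = h x + h y"
    and "\<And>a x. x \<in> V \<Longrightarrow> h (scl a x) = scl a (h x)"
  using assms by (auto simp: linear_iso_def iso_def hom_def chain_space_def)

lemma linear_iso_inv_comp:
  fixes Q :: "('k::field, 'v) module"
  assumes V: "chains.subspace V" and W: "chains.subspace W"
    and f: "f \<in> linear_iso (chain_space V) Q" and g: "g \<in> linear_iso (chain_space W) Q"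
  shows "(\<lambda>x. inv_into W g (f x)) \<in> linear_iso (chain_space V) (chain_space W)"
proof -
  have fb: "bij_betw f V (carrier Q)" and gb: "bij_betw g W (carrier Q)"
    using f g by (auto simp: linear_iso_def iso_def chain_space_def)
  have fadd: "f (x + y) = f x \<oplus>\<^bsub>Q\<^esub> f y" if "x \<in> V" "y \<in> V" for x y
    using f that by (auto simp: linear_iso_def iso_def hom_def chain_space_def)
  have gadd: "g (x + y) = g x \<oplus>\<^bsub>Q\<^esub> g y" if "x \<in> W" "y \<in> W" for x y
    using g that by (auto simp: linear_iso_def iso_def hom_def chain_space_def)
  have fs: "f (scl a x) = a \<odot>\<^bsub>Q\<^esub> f x" if "x \<in> V" for a x
    using f that by (auto simp: linear_iso_def chain_space_def)
  have gs: "g (scl a x) = a \<odot>\<^bsub>Q\<^esub> g x" if "x \<in> W" for a x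
    using g that by (auto simp: linear_iso_def chain_space_def)
  let ?h = "\<lambda>x. inv_into W g (f x)"
  have hb: "bij_betw ?h V W"
    using bij_betw_trans[OF fb bij_betw_inv_into[OF gb]] by (simp add: comp_def)
  have hW: "?h x \<in> W" if "x \<in> V" for x using hb that by (auto simp: bij_betw_def)
  have gh: "g (?h x) = f x" if "x \<in> V" for x
    using that fb gb by (metis bij_betw_apply bij_betw_inv_into_right)
  have eqI: "?h x = y" if "x \<in> V" "y \<in> W" "f x = g y" for x y
    using that gb by (metis bij_betw_inv_into_left)
  have "?h (x + y) = ?h x + ?h y" if "x \<in> V" "y \<in> V" for x y
    using that by (intro eqI) (simp_all add: subspace_closed(1)[OF V] subspace_closed(1)[OF W] hW fadd gadd gh)
  moreover have "?h (scl a x) = scl a (?h x)" if "x \<in> V" for a x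
    using that by (intro eqI) (simp_all add: subspace_closed(2)[OF V] subspace_closed(2)[OF W] hW fs gs gh)
  ultimately show ?thesis
    using hb hW by (auto simp: linear_iso_def iso_def hom_def chain_space_def)
qed

lemma pm_isomorphic_interval_sumE:
  fixes P :: "('k::field, 'v) persistence_module"
  assumes "pm_isomorphic (interval_sum Is) P"
  obtains \<phi> where
    "\<And>t. 0 < t \<Longrightarrow>
       \<phi> t \<in> linear_iso (chain_space (supported {j. j < length Is \<and> t \<in> Is ! j})) (space_at P t)"
    "\<And>s t c. 0 < s \<Longrightarrow> s \<le> t \<Longrightarrow> c \<in> supported {j. j < length Is \<and> s \<in> Is ! j} \<Longrightarrow>
       \<phi> t (transition (interval_sum Is) s t c) = transition P s t (\<phi> s c)"
proof -
  from assms obtain \<phi> where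
    "\<forall>t>0. \<phi> t \<in> linear_iso (space_at (interval_sum Is) t) (space_at P t)"
    "\<forall>s t. 0 < s \<longrightarrow> s \<le> t \<longrightarrow> (\<forall>c \<in> carrier (space_at (interval_sum Is) s).
        \<phi> t (transition (interval_sum Is) s t c) = transition P s t (\<phi> s c))"
    unfolding pm_isomorphic_def by (elim exE conjE) 
  then show thesis
    by (intro that[of \<phi>]) (simp_all add: space_at_interval_sum)
qed

text \<open>
  The multiset of intervals is defined by a choice among all decompositions. Any two
  decompositions of the same module give isomorphic sums, which reduces
  every question about the chosen one to the elder decomposition.
\<close>

lemma pm_isomorphic_interval_sums:
  fixes P :: "('k::field, 'v) persistence_module"
  assumes "pm_isomorphic (interval_sum Is) P" "pm_isomorphic (interval_sum Js) P"
  shows "pm_isomorphic (interval_sum Is :: ('k, _) persistence_module) (interval_sum Js)"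
proof -
  let ?V = "\<lambda>t. supported {j. j < length Is \<and> t \<in> Is ! j} :: (nat \<Rightarrow>\<^sub>0 'k) set"
  let ?W = "\<lambda>t. supported {j. j < length Js \<and> t \<in> Js ! j} :: (nat \<Rightarrow>\<^sub>0 'k) set"
  obtain \<phi> where \<phi>: "\<And>t. 0 < t \<Longrightarrow> \<phi> t \<in> linear_iso (chain_space (?V t)) (space_at P t)"
    "\<And>s t c. 0 < s \<Longrightarrow> s \<le> t \<Longrightarrow> c \<in> ?V s \<Longrightarrow>
        \<phi> t (transition (interval_sum Is) s t c) = transition P s t (\<phi> s c)"
    by (fact pm_isomorphic_interval_sumE[OF assms(1)])
  obtain \<psi> where \<psi>: "\<And>t. 0 < t \<Longrightarrow> \<psi> t \<in> linear_iso (chain_space (?W t)) (space_at P t)"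
    "\<And>s t c. 0 < s \<Longrightarrow> s \<le> t \<Longrightarrow> c \<in> ?W s \<Longrightarrow>
        \<psi> t (transition (interval_sum Js) s t c) = transition P s t (\<psi> s c)"
    by (fact pm_isomorphic_interval_sumE[OF assms(2)])
  define h where "h t x = inv_into (?W t) (\<psi> t) (\<phi> t x)" for t x
  have iso: "h t \<in> linear_iso (chain_space (?V t)) (chain_space (?W t))" if "0 < t" for t
    unfolding h_def by (rule linear_iso_inv_comp[OF subspace_supported subspace_supported \<phi>(1) \<psi>(1)]) fact+
  have \<psi>b: "bij_betw (\<psi> t) (?W t) (carrier (space_at P t))" if "0 < t" for t
    using \<psi>(1)[OF that] by (auto simp: linear_iso_def iso_def chain_space_def)
  have \<phi>b: "bij_betw (\<phi> t) (?V t) (carrier (space_at P t))" if "0 < t" for t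
    using \<phi>(1)[OF that] by (auto simp: linear_iso_def iso_def chain_space_def)
  have hW: "h t x \<in> ?W t" if "0 < t" "x \<in> ?V t" for t x
    using linear_iso_chain_spaceD(1)[OF iso[OF that(1)]] that(2) by (auto simp: bij_betw_def)
  have \<psi>h: "\<psi> t (h t x) = \<phi> t x" if "0 < t" "x \<in> ?V t" for t x
    unfolding h_def
    using bij_betw_inv_into_right[OF \<psi>b[OF that(1)] bij_betw_apply[OF \<phi>b[OF that(1)] that(2)]] .
  have trans_W: "transition (interval_sum Js) s t c \<in> ?W t" if "c \<in> ?W s" for s t c
  proof -
    have "(\<Sum>j\<in>{j \<in> Poly_Mapping.keys c. t \<in> Js ! j}.
        Poly_Mapping.single j (Poly_Mapping.lookup c j)) \<in> ?W t"
      using that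
      by (intro chains.subspace_sum[OF subspace_supported] single_in_supported)
        (auto simp: supported_def)
    then show ?thesis by (simp add: interval_sum_def)
  qed
  have "h t (transition (interval_sum Is) s t c) = transition (interval_sum Js) s t (h s c)"
    if st: "0 < s" "s \<le> t" and c: "c \<in> ?V s" for s t c
  proof -
    have t: "0 < t" using st by simp
    have "\<phi> t (transition (interval_sum Is) s t c) = transition P s t (\<psi> s (h s c))"
      using \<phi>(2)[OF st c] \<psi>h[OF st(1) c] by simp
    also have "\<dots> = \<psi> t (transition (interval_sum Js) s t (h s c))"
      using \<psi>(2)[OF st hW[OF st(1) c]] by simp
    finally show ?thesis
      unfolding h_def using bij_betw_inv_into_left[OF \<psi>b[OF t] trans_W[OF hW[OF st(1) c]]]
      by (simp add: h_def)
  qed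
  with iso show ?thesis
    unfolding pm_isomorphic_def space_at_interval_sum
    by (intro exI[of _ h]) auto
qed

text \<open>
  This is invariance of dimension: the images of the basis vectors are independent and lie
  in a space spanned by \<open>card J\<close> vectors.
\<close>

lemma linear_iso_card_le:
  assumes h: "h \<in> linear_iso (chain_space (supported I :: ('b \<Rightarrow>\<^sub>0 'k::field) set)) (chain_space (supported J :: ('c \<Rightarrow>\<^sub>0 'k) set))"
    and fin: "finite I" "finite J"
  shows "card I \<le> card J"
proof -
  note h = linear_iso_chain_spaceD[OF h]
  let ?e = "\<lambda>j. Poly_Mapping.single j (1 :: 'k)"
  have inj: "inj_on (\<lambda>i. h (?e i)) I"
  proof (rule inj_onI)
    fix i j assume "i \<in> I" "j \<in> I" "h (?e i) = h (?e j)"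
    then have "?e i = ?e j"
      using h(1) by (auto simp: bij_betw_def inj_on_def single_in_supported)
    then have "Poly_Mapping.lookup (?e i) i = Poly_Mapping.lookup (?e j) i" by simp
    then show "i = j" by (simp add: lookup_single when_def split: if_splits)
  qed
  have zero: "h 0 = 0"
    using h(3)[OF subspace_closed(3)[OF subspace_supported], of 0] by simp
  have sum: "T \<subseteq> I \<Longrightarrow> (\<Sum>i\<in>T. scl (a i) (h (?e i))) = h (\<Sum>i\<in>T. scl (a i) (?e i))" if "finite T" for T a
    using that
  proof (induction T)
    case (insert i T)
    have *: "(\<Sum>i\<in>T. scl (a i) (?e i)) \<in> supported I"
      using insert by (intro chains.subspace_sum[OF subspace_supported]) (auto intro: single_in_supported)
    have "(\<Sum>i\<in>insert i T. scl (a i) (h (?e i))) = scl (a i) (h (?e i)) + h (\<Sum>i\<in>T. scl (a i) (?e i))"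
      using insert by simp
    also have "\<dots> = h (scl (a i) (?e i) + (\<Sum>i\<in>T. scl (a i) (?e i)))"
      using insert.prems * h(2)[of "scl (a i) (?e i)"] h(3)[of "?e i" "a i"]
      by (simp add: single_in_supported)
    finally show ?case using insert by simp
  qed (simp add: zero)
  have "chains.independent ((\<lambda>i. h (?e i)) ` I)"
  proof (rule chains.independent_if_scalars_zero)
    fix f x assume s: "(\<Sum>x\<in>(\<lambda>i. h (?e i)) ` I. scl (f x) x) = 0" and x: "x \<in> (\<lambda>i. h (?e i)) ` I"
    define a where "a i = f (h (?e i))" for i
    have "h (\<Sum>i\<in>I. scl (a i) (?e i)) = (\<Sum>i\<in>I. scl (a i) (h (?e i)))"
      by (rule sum[symmetric]) (use fin in auto)
    also have "\<dots> = 0" using s by (simp add: sum.reindex[OF inj] a_def)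
    finally have "h (\<Sum>i\<in>I. scl (a i) (?e i)) = h 0" by (simp add: zero)
    moreover have "(\<Sum>i\<in>I. scl (a i) (?e i)) \<in> supported I"
      by (intro chains.subspace_sum[OF subspace_supported]) (auto intro: single_in_supported)
    ultimately have 0: "(\<Sum>i\<in>I. scl (a i) (?e i)) = 0"
      using h(1) subspace_closed(3)[OF subspace_supported] unfolding bij_betw_def inj_on_def by blast
    obtain i where i: "i \<in> I" "x = h (?e i)" using x by auto
    have "Poly_Mapping.lookup (\<Sum>i\<in>I. scl (a i) (?e i)) i = a i"
      using i(1) fin(1) by (simp add: lookup_sum lookup_single when_def)
    then show "f x = 0" using 0 i(2) by (simp add: a_def)
  qed (use fin in simp)
  moreover have "(\<lambda>i. h (?e i)) ` I \<subseteq> chains.span (?e ` J)"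
  proof clarify
    fix i assume "i \<in> I"
    then have "h (?e i) \<in> supported J" using h(1) by (auto simp: bij_betw_def single_in_supported)
    moreover have "lincomb ?e c \<in> chains.span (?e ` J)" if "c \<in> supported J" for c
      using that by (intro lincomb_in_subspace chains.subspace_span chains.span_base)
        (auto simp: supported_def)
    ultimately show "h (?e i) \<in> chains.span (?e ` J)"
      by (metis lincomb_single_self)
  qed
  ultimately have "card ((\<lambda>i. h (?e i)) ` I) \<le> card (?e ` J)"
    using chains.independent_span_bound[of "?e ` J"] fin(2) by blast
  also have "\<dots> \<le> card J" using fin(2) by (rule card_image_le)
  finally show ?thesis by (simp add: card_image[OF inj])
qed

lemma interval_sum_card_le:
  assumes "pm_isomorphic (interval_sum Is :: ('k::field, _) persistence_module) (interval_sum Js)" "0 < t"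
  shows "card {j. j < length Is \<and> t \<in> Is ! j} \<le> card {j. j < length Js \<and> t \<in> Js ! j}"
proof -
  obtain \<phi> where "\<phi> t \<in> linear_iso
    (chain_space (supported {j. j < length Is \<and> t \<in> Is ! j} :: (nat \<Rightarrow>\<^sub>0 'k) set))
    (chain_space (supported {j. j < length Js \<and> t \<in> Js ! j}))"
    using assms unfolding pm_isomorphic_def space_at_interval_sum by blast
  then show ?thesis by (rule linear_iso_card_le) auto
qed

text \<open>
  An interval module has surjective transition maps if and only if its interval contains,
  with each scale, all smaller positive ones; and surjectivity is invariant under
  isomorphism. Concretely, a basis vector at scale \<open>t\<close> corresponds to some \<open>y\<close> in the
  other sum; since \<open>y\<close> already lives at scale \<open>s\<close>, the basis vector comes from a
  vector \<open>z\<close> at scale \<open>s\<close>, and its index must occur in \<open>z\<close>.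
\<close>

lemma interval_sum_downward_closed:
  assumes iso: "pm_isomorphic (interval_sum Is :: ('k::field, _) persistence_module) (interval_sum Js)"
    and down: "\<And>j s t. j < length Js \<Longrightarrow> 0 < s \<Longrightarrow> s \<le> t \<Longrightarrow> t \<in> Js ! j \<Longrightarrow> s \<in> Js ! j"
    and j: "j < length Is" "t \<in> Is ! j" and st: "0 < s" "s \<le> t"
  shows "s \<in> Is ! j"
proof -
  let ?V = "\<lambda>t. supported {j. j < length Is \<and> t \<in> Is ! j} :: (nat \<Rightarrow>\<^sub>0 'k) set"
  let ?W = "\<lambda>t. supported {j. j < length Js \<and> t \<in> Js ! j} :: (nat \<Rightarrow>\<^sub>0 'k) set"
  have t: "0 < t" using st by simp
  obtain \<phi> where \<phi>: "\<And>t. 0 < t \<Longrightarrow> \<phi> t \<in> linear_iso (chain_space (?V t)) (chain_space (?W t))"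
    "\<And>s t c. 0 < s \<Longrightarrow> s \<le> t \<Longrightarrow> c \<in> ?V s \<Longrightarrow>
        \<phi> t (transition (interval_sum Is) s t c) = transition (interval_sum Js) s t (\<phi> s c)"
    by (fact pm_isomorphic_interval_sumE[OF iso, unfolded space_at_interval_sum])
  note b = linear_iso_chain_spaceD(1)[OF \<phi>(1)]
  let ?x = "Poly_Mapping.single j 1 :: nat \<Rightarrow>\<^sub>0 'k"
  have x: "?x \<in> ?V t" using j by (auto intro: single_in_supported)
  then have y: "\<phi> t ?x \<in> ?W t" using b[OF t] by (auto simp: bij_betw_def)
  then have ys: "\<phi> t ?x \<in> ?W s"
    using down[OF _ st] by (fastforce simp: supported_def)
  have "transition (interval_sum Js) s t (\<phi> t ?x) =
      lincomb (\<lambda>j. Poly_Mapping.single j 1) (\<phi> t ?x)"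
    using y by (auto simp: interval_sum_def lincomb_def supported_def intro!: sum.cong)
  then have yy: "transition (interval_sum Js) s t (\<phi> t ?x) = \<phi> t ?x"
    by (simp add: lincomb_single_self)
  have "\<phi> t ?x \<in> \<phi> s ` ?V s"
    using bij_betw_imp_surj_on[OF b[OF st(1)]] ys by simp
  then obtain z where z: "z \<in> ?V s" "\<phi> s z = \<phi> t ?x"
    by (elim imageE) simp
  define r where "r = transition (interval_sum Is :: ('k, _) persistence_module) s t z"
  have r: "r = (\<Sum>i\<in>{i \<in> Poly_Mapping.keys z. t \<in> Is ! i}. Poly_Mapping.single i (Poly_Mapping.lookup z i))"
    by (simp add: r_def interval_sum_def)
  have "r \<in> ?V t"
    unfolding r using z(1)
    by (intro chains.subspace_sum[OF subspace_supported] single_in_supported) (auto simp: supported_def)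
  moreover have "\<phi> t r = \<phi> t ?x"
    unfolding r_def using \<phi>(2)[OF st z(1)] z(2) yy by simp
  ultimately have "r = ?x"
    using x b[OF t] unfolding bij_betw_def inj_on_def by blast
  then have "Poly_Mapping.lookup r j \<noteq> 0" by simp
  moreover have "Poly_Mapping.lookup r j = 0" if "j \<notin> Poly_Mapping.keys z"
    unfolding r lookup_sum using that
    by (intro sum.neutral) (auto simp: lookup_single when_def)
  ultimately have "j \<in> Poly_Mapping.keys z" by blast
  then show ?thesis using z(1) by (auto simp: supported_def)
qed

section \<open>Intervals alive at a scale and separated subsets\<close>

text \<open>
  These are the only properties of the two filtrations that matter below. The last two
  compare their edges with the distance, up to a factor of two: the balls of radius \<open>t\<close>
  around two points can meet only if the points are closer than \<open>2 * t\<close>.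
\<close>

lemma filtration_simplices:
  fixes S :: "'a::metric_space set"
  assumes F: "F \<in> {cech, rips}" and t: "0 < t"
  shows "{v. {v} \<in> F S t} = S"
    and "\<sigma> \<in> F S t \<Longrightarrow> \<sigma> \<subseteq> S"
    and "s \<le> t \<Longrightarrow> F S s \<subseteq> F S t"
    and "u \<in> S \<Longrightarrow> v \<in> S \<Longrightarrow> dist u v < t \<Longrightarrow> {u, v} \<in> F S t"
    and "{u, v} \<in> F S t \<Longrightarrow> dist u v < 2 * t"
proof -
  show "{v. {v} \<in> F S t} = S"
    using F t by (auto simp: cech_def rips_def)
  show "\<sigma> \<in> F S t \<Longrightarrow> \<sigma> \<subseteq> S"
    using F by (auto simp: cech_def rips_def)
  show "F S s \<subseteq> F S t" if "s \<le> t"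
  proof -
    have "(\<Inter>y\<in>\<sigma>. ball y s) \<subseteq> (\<Inter>y\<in>\<sigma>. ball y t)" for \<sigma> :: "'a set"
      using subset_ball[OF that] by blast
    then have "cech S s \<subseteq> cech S t" unfolding cech_def by blast
    moreover have "rips S s \<subseteq> rips S t"
      using that unfolding rips_def by (blast intro: less_le_trans)
    ultimately show ?thesis using F by auto
  qed
  show "{u, v} \<in> F S t" if "u \<in> S" "v \<in> S" "dist u v < t"
  proof -
    have "v \<in> ball u t \<inter> ball v t" using that t by simp
    then have "(\<Inter>y\<in>{u, v}. ball y t) \<noteq> {}" by auto
    then have "{u, v} \<in> cech S t" using that(1,2) unfolding cech_def by blast
    moreover have "{u, v} \<in> rips S t" using that t by (auto simp: rips_def dist_commute)
    ultimately show ?thesis using F by auto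
  qed
  show "dist u v < 2 * t" if uv: "{u, v} \<in> F S t"
  proof (cases "F = rips")
    case True
    then have "dist u v < t" using uv by (auto simp: rips_def)
    then show ?thesis using t by simp
  next
    case False
    then have "F = cech" using F by simp
    then obtain w where "dist u w < t" "dist v w < t" using uv by (auto simp: cech_def)
    then show ?thesis using dist_triangle2[of u v w] by simp
  qed
qed

lemma homologous_discrete:
  assumes "\<And>x y. {x, y} \<in> K \<Longrightarrow> x = y" and "homologous (k :: 'k::field itself) K u v"
  shows "u = v"
proof -
  define f where "f x = (if x = u then 1 else 0 :: 'k)" for x
  have "pairing f (Poly_Mapping.single u 1 - Poly_Mapping.single v 1) = 0"
    using assms by (intro pairing_boundary[of K]) (auto simp: homologous_def f_def)
  then show ?thesis by (auto simp: pairing_diff f_def split: if_splits)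
qed

lemma finite_separation:
  fixes S :: "'a::metric_space set"
  assumes "finite S"
  shows "\<exists>d>0. \<forall>u\<in>S. \<forall>v\<in>S. u \<noteq> v \<longrightarrow> d \<le> dist u v"
proof -
  define D where "D = insert 1 ((\<lambda>(u, v). dist u v) ` {(u, v) \<in> S \<times> S. u \<noteq> v})"
  have "finite D" unfolding D_def using assms
    by (intro finite.insertI finite_imageI) (rule finite_subset[of _ "S \<times> S"], auto)
  moreover have "D \<noteq> {}" "\<forall>d\<in>D. 0 < d" by (auto simp: D_def)
  moreover have "dist u v \<in> D" if "u \<in> S" "v \<in> S" "u \<noteq> v" for u v
    using that by (force simp: D_def)
  ultimately show ?thesis
    by (intro exI[of _ "Min D"]) auto
qed

text \<open>
  The first part of the proof shows that the elder intervals really form a decomposition,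
  so that the chosen multiset decomposes the homology as well. The counting bound
  then comes from the elder rule: the vertices whose
  elder intervals contain \<open>t\<close>, together with the oldest vertex, are pairwise non-homologous
  at scale \<open>t\<close>, hence not joined by an edge, hence at distance at least \<open>t\<close>. The oldest
  vertex makes the inequality strict, so that a scale with a living interval has two
  points at this distance.
\<close>

theorem PH0_counting:
  fixes S :: "'a::metric_space set"
  assumes S: "finite S" "S \<noteq> {}" and F: "F \<in> {cech, rips}"
  obtains Is where "mset Is = PH0 TYPE('k::field) (F S)"
    and "\<And>I. I \<in> set Is \<Longrightarrow> I \<noteq> {}" "\<And>I. I \<in> set Is \<Longrightarrow> I \<subseteq> {0<..}"
    and "\<And>I s t. I \<in> set Is \<Longrightarrow> 0 < s \<Longrightarrow> s \<le> t \<Longrightarrow> t \<in> I \<Longrightarrow> s \<in> I"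
    and "\<And>t. 0 < t \<Longrightarrow> \<exists>C\<subseteq>S. card {j. j < length Is \<and> t \<in> Is ! j} < card C \<and>
           (\<forall>u\<in>C. \<forall>v\<in>C. u \<noteq> v \<longrightarrow> t \<le> dist u v)"
proof -
  note simplices = filtration_simplices[OF F, where S = S]
  let ?k = "TYPE('k)"
  obtain xs where xs: "set xs = S" "distinct xs" using finite_distinct_list S by blast
  define n where "n = length xs - 1"
  have len: "length xs = Suc n" using xs S by (cases xs) (auto simp: n_def)
  define el where "el = elder_interval ?k (F S) xs"
  define Js where "Js = map el [0..<n]"
  have mono: "F S s \<subseteq> F S t" if "0 < s" "s \<le> t" for s t
    using that by (intro simplices(3)) auto
  have down: "s \<in> el i" if "0 < s" "s \<le> t" "t \<in> el i" for i s t
    using that homologous_mono[OF mono[OF that(1,2)]] by (auto simp: el_def elder_interval_def)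
  have iso: "pm_isomorphic (interval_sum Js) (reduced_H0 (F S) :: ('k, ('a \<Rightarrow>\<^sub>0 'k) set) persistence_module)"
    unfolding Js_def el_def n_def
    by (rule elder_decomposition) (use xs S simplices mono in auto)
  obtain d where d: "0 < d" "\<And>u v. u \<in> S \<Longrightarrow> v \<in> S \<Longrightarrow> u \<noteq> v \<Longrightarrow> d \<le> dist u v"
    using finite_separation[OF S(1)] by blast
  have small: "d / 2 \<in> el i" if "i < n" for i
  proof -
    have "x = y" if "{x, y} \<in> F S (d / 2)" for x y
      using simplices(2)[of "d / 2" "{x, y}"] simplices(5)[of "d / 2" x y] d that by force
    then have "\<not> homologous ?k (F S (d / 2)) (xs ! Suc i) (xs ! j)" if "j \<le> i" for j
      using homologous_discrete[of "F S (d / 2)" ?k "xs ! Suc i" "xs ! j"] that \<open>i < n\<close> xs(2) len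
      by (auto simp: nth_eq_iff_index_eq)
    then show ?thesis using d(1) by (simp add: el_def elder_interval_def)
  qed
  have "interval_decomposition (reduced_H0 (F S) :: ('k, ('a \<Rightarrow>\<^sub>0 'k) set) persistence_module) (mset Js)"
    unfolding interval_decomposition_def
  proof (intro conjI ballI)
    fix I assume "I \<in># mset Js"
    then obtain i where i: "i < n" "I = el i" by (auto simp: Js_def)
    show "I \<noteq> {}" using small i by blast
    show I: "I \<subseteq> {0<..}" using i by (auto simp: el_def elder_interval_def)
    show "is_interval I"
      unfolding is_interval_1
    proof (intro ballI allI impI)
      fix a b x assume "a \<in> I" "b \<in> I" "a \<le> x \<and> x \<le> b"
      then show "x \<in> I" using I down[of x b i] i(2) by auto
    qed
  qed (use iso in blast)
  then have PH: "interval_decomposition (reduced_H0 (F S) :: ('k, ('a \<Rightarrow>\<^sub>0 'k) set) persistence_module) (PH0 ?k (F S))"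
    unfolding PH0_def by (rule someI)
  then obtain Is where Is: "mset Is = PH0 ?k (F S)"
    "pm_isomorphic (interval_sum Is) (reduced_H0 (F S) :: ('k, ('a \<Rightarrow>\<^sub>0 'k) set) persistence_module)"
    unfolding interval_decomposition_def by blast
  have IJ: "pm_isomorphic (interval_sum Is :: ('k, _) persistence_module) (interval_sum Js)"
    by (rule pm_isomorphic_interval_sums[OF Is(2) iso])
  show thesis
  proof (rule that[OF Is(1)])
    fix I assume I: "I \<in> set Is"
    then have "I \<in># PH0 ?k (F S)" by (simp flip: Is(1))
    then show "I \<noteq> {}" "I \<subseteq> {0<..}" using PH by (auto simp: interval_decomposition_def)
    fix s t :: real assume st: "0 < s" "s \<le> t" and tI: "t \<in> I"
    obtain j where "j < length Is" "I = Is ! j" using I by (auto simp: in_set_conv_nth)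
    then show "s \<in> I"
      using interval_sum_downward_closed[OF IJ _ _ _ st, of j] tI down by (auto simp: Js_def)
  next
    fix t :: real assume t: "0 < t"
    define A where "A = {j. j < length Js \<and> t \<in> Js ! j}"
    define C where "C = (!) xs ` insert 0 (Suc ` A)"
    have A: "j < n" "t \<in> el j" if "j \<in> A" for j using that by (auto simp: A_def Js_def)
    have "inj_on ((!) xs) (insert 0 (Suc ` A))"
      using A(1) xs(2) len by (auto simp: inj_on_def nth_eq_iff_index_eq)
    then have "card C = Suc (card A)"
      unfolding C_def by (subst card_image) (auto simp: A_def card_image)
    moreover have "card {j. j < length Is \<and> t \<in> Is ! j} \<le> card A"
      unfolding A_def by (rule interval_sum_card_le[OF IJ t])
    moreover have "C \<subseteq> S" using A(1) len xs(1) by (auto simp: C_def)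
    moreover have sep: "t \<le> dist (xs ! Suc i) (xs ! j)" if "i \<in> A" "j \<le> i" for i j
    proof (rule ccontr)
      assume "\<not> ?thesis"
      then have "{xs ! Suc i, xs ! j} \<in> F S t"
        using A(1)[OF that(1)] that(2) len xs(1) t by (intro simplices(4)) auto
      then have "homologous ?k (F S t) (xs ! Suc i) (xs ! j)" by (rule homologous_edge)
      then show False using A(2)[OF that(1)] that(2) by (auto simp: el_def elder_interval_def)
    qed
    have "t \<le> dist u v" if "u \<in> C" "v \<in> C" "u \<noteq> v" for u v
    proof -
      obtain a b where ab: "a \<in> insert 0 (Suc ` A)" "u = xs ! a" "b \<in> insert 0 (Suc ` A)" "v = xs ! b"
        using \<open>u \<in> C\<close> \<open>v \<in> C\<close> by (auto simp: C_def)
      have "a \<noteq> b" using ab \<open>u \<noteq> v\<close> by auto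
      then consider "b < a" | "a < b" by linarith
      then show ?thesis
      proof cases
        case 1
        then obtain i where "a = Suc i" "i \<in> A" using ab by auto
        then show ?thesis using sep[of i b] 1 ab by simp
      next
        case 2
        then obtain i where "b = Suc i" "i \<in> A" using ab by auto
        then show ?thesis using sep[of i a] 2 ab by (simp add: dist_commute)
      qed
    qed
    ultimately show "\<exists>C\<subseteq>S. card {j. j < length Is \<and> t \<in> Is ! j} < card C \<and>
           (\<forall>u\<in>C. \<forall>v\<in>C. u \<noteq> v \<longrightarrow> t \<le> dist u v)"
      by (intro exI[of _ C]) auto
  qed
qed

section \<open>Power sums and counting functions\<close>

text \<open>
  By induction, the step being \<open>n powr (1 - s) + (1 - s) * N powr - s \<le> N powr (1 - s)\<close> with
  \<open>N = n + 1\<close>. Multiplied by \<open>N powr s\<close> this is the weighted inequality between the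
  geometric and the arithmetic mean of \<open>n\<close> and \<open>N\<close>.
\<close>

lemma sum_powr_neg_le:
  fixes s :: real
  assumes s: "0 < s" "s < 1"
  shows "(\<Sum>k=1..n. real k powr - s) \<le> real n powr (1 - s) / (1 - s)"
proof (induction n)
  case (Suc n)
  define N where "N = real (Suc n)"
  have N: "0 < N" by (simp add: N_def)
  have "real n powr (1 - s) * N powr s \<le> (1 - s) * real n + s * N"
    using s N Youngs_inequality_0[of "1 - s" s "real n" N] by (cases "n = 0") auto
  also have "\<dots> = N - (1 - s)" by (simp add: N_def algebra_simps)
  finally have "(real n powr (1 - s) * N powr s) * N powr - s \<le> (N - (1 - s)) * N powr - s"
    by (rule mult_right_mono) simp
  moreover have "N powr s * N powr - s = 1" "N * N powr - s = N powr (1 - s)"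
    using N powr_mult_base[of N "- s"] by (simp_all flip: powr_add)
  ultimately have "real n powr (1 - s) + (1 - s) * N powr - s \<le> N powr (1 - s)"
    by (simp add: mult.assoc left_diff_distrib)
  then have "(real n powr (1 - s) + (1 - s) * N powr - s) / (1 - s) \<le> N powr (1 - s) / (1 - s)"
    using s by (intro divide_right_mono) auto
  then have "real n powr (1 - s) / (1 - s) + N powr - s \<le> N powr (1 - s) / (1 - s)"
    using s by (simp add: add_divide_distrib)
  then show ?case using Suc by (simp add: N_def)
qed simp

text \<open>
  Listed in decreasing order, the \<open>k\<close>-th value \<open>b\<close> satisfies \<open>k \<le> C * b powr - d\<close>, that is,
  \<open>b \<le> (C / k) powr (1 / d)\<close>. Removing a least value in each induction step replaces the
  sorting.
\<close>

lemma sum_powr_le_of_counting: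
  fixes b :: "'i \<Rightarrow> real"
  assumes "finite A" "\<And>i. i \<in> A \<Longrightarrow> 0 \<le> b i" and pos: "0 < C" "0 < d" "0 < \<alpha>"
    and "\<And>t. 0 < t \<Longrightarrow> real (card {i\<in>A. t \<le> b i}) \<le> C * t powr - d"
  shows "(\<Sum>i\<in>A. b i powr \<alpha>) \<le> C powr (\<alpha> / d) * (\<Sum>k=1..card A. real k powr - (\<alpha> / d))"
  using assms(1,2,6)
proof (induction "card A" arbitrary: A)
  case (Suc n)
  then have "A \<noteq> {}" by auto
  then obtain a where a: "a \<in> A" "\<And>i. i \<in> A \<Longrightarrow> b a \<le> b i"
    using ex_is_arg_min_if_finite[OF \<open>finite A\<close>, of b] by (auto simp: is_arg_min_linorder)
  have card: "card (A - {a}) = n" using Suc a by simp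
  have cnt: "real (card {i\<in>A - {a}. t \<le> b i}) \<le> C * t powr - d" if "0 < t" for t
  proof -
    have "card {i\<in>A - {a}. t \<le> b i} \<le> card {i\<in>A. t \<le> b i}"
      using \<open>finite A\<close> by (intro card_mono) auto
    then show ?thesis using Suc.prems(3)[OF that] by linarith
  qed
  have "b a powr \<alpha> \<le> C powr (\<alpha> / d) * real (Suc n) powr - (\<alpha> / d)"
  proof (cases "b a = 0")
    case False
    then have ba: "0 < b a" using Suc.prems(2) a(1) by (simp add: less_le)
    have "{i\<in>A. b a \<le> b i} = A" using a(2) by auto
    then have "real (Suc n) \<le> C * b a powr - d"
      using Suc.prems(3)[OF ba] Suc.hyps(2) by simp
    then have "b a powr d \<le> C / real (Suc n)"
      using ba by (simp add: powr_minus field_simps)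
    then have "(b a powr d) powr (\<alpha> / d) \<le> (C / real (Suc n)) powr (\<alpha> / d)"
      using pos by (intro powr_mono2) auto
    moreover have "(b a powr d) powr (\<alpha> / d) = b a powr \<alpha>"
      using pos by (simp add: powr_powr)
    moreover have "(C / real (Suc n)) powr (\<alpha> / d) = C powr (\<alpha> / d) * real (Suc n) powr - (\<alpha> / d)"
      using pos powr_divide[of C "real (Suc n)" "\<alpha> / d"]
      by (simp add: powr_minus_divide del: of_nat_Suc)
    ultimately show ?thesis by simp
  qed simp
  moreover have "(\<Sum>i\<in>A - {a}. b i powr \<alpha>) \<le> C powr (\<alpha> / d) * (\<Sum>k=1..n. real k powr - (\<alpha> / d))"
    using Suc.hyps(1)[of "A - {a}"] card Suc.prems(1,2) cnt by simp
  ultimately show ?case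
    using sum.remove[OF \<open>finite A\<close> a(1), of "\<lambda>i. b i powr \<alpha>"]
    by (simp flip: Suc.hyps(2) add: distrib_left)
qed simp

section \<open>Packing numbers and the box dimension\<close>

lemma eln_lessD:
  assumes "eln x < ereal y"
  shows "x \<le> ereal (exp y)"
proof (cases x)
  case (real r)
  then show ?thesis
  proof (cases "0 < r")
    case True
    then have "ln r < y" using assms real by (simp add: eln_def)
    then show ?thesis using True real by (metis ereal_less_eq(3) exp_le_cancel_iff exp_ln less_imp_le)
  qed (use real in \<open>simp add: order_trans[OF _ less_imp_le[OF exp_gt_zero]]\<close>)
qed (use assms in \<open>auto simp: eln_def\<close>)

lemma eln_le:
  assumes "x \<le> ereal r" "0 < r"
  shows "eln x \<le> ereal (ln r)"
  using assms by (cases x) (auto simp: eln_def)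

lemma packing_number_le_powr:
  fixes X :: "'a::metric_space set"
  assumes "upper_box_dim X < ereal d"
  obtains \<delta> where "0 < \<delta>"
    "\<And>\<epsilon>. 0 < \<epsilon> \<Longrightarrow> \<epsilon> \<le> \<delta> \<Longrightarrow> packing_number \<epsilon> X \<le> ereal (\<epsilon> powr - d)"
proof -
  have "eventually (\<lambda>\<delta>. eln (packing_number \<delta> X) / ereal (- ln \<delta>) < ereal d) (at_right 0)"
    using assms unfolding upper_box_dim_def by (rule Limsup_lessD)
  then obtain b :: real where b: "0 < b"
    "\<And>\<epsilon>. 0 < \<epsilon> \<Longrightarrow> \<epsilon> < b \<Longrightarrow> eln (packing_number \<epsilon> X) / ereal (- ln \<epsilon>) < ereal d"
    unfolding eventually_at_right_field by blast
  define \<delta> where "\<delta> = min b 1 / 2"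
  have *: "packing_number \<epsilon> X \<le> ereal (\<epsilon> powr - d)" if "0 < \<epsilon>" "\<epsilon> \<le> \<delta>" for \<epsilon>
  proof -
    have e: "\<epsilon> < b" "\<epsilon> < 1" using that b(1) by (auto simp: \<delta>_def)
    then have "0 < - ln \<epsilon>" using that by (simp add: ln_less_zero)
    then have "eln (packing_number \<epsilon> X) < ereal (- ln \<epsilon>) * ereal d"
      using b(2)[OF that(1) e(1)] by (subst (asm) ereal_divide_less_pos) auto
    then have "eln (packing_number \<epsilon> X) < ereal (- ln \<epsilon> * d)"
      by simp
    then have "packing_number \<epsilon> X \<le> ereal (exp (- ln \<epsilon> * d))" by (rule eln_lessD)
    then show ?thesis using that by (simp add: powr_def mult.commute)
  qed
  have "0 < \<delta>" using b(1) by (simp add: \<delta>_def)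
  then show thesis using * by (rule that)
qed

lemma card_separated_le:
  assumes "finite C" "C \<subseteq> X" "\<And>u v. u \<in> C \<Longrightarrow> v \<in> C \<Longrightarrow> u \<noteq> v \<Longrightarrow> 2 * \<delta> \<le> dist u v"
  shows "ereal (real (card C)) \<le> packing_number \<delta> X"
proof -
  have "ball u \<delta> \<inter> ball v \<delta> = {}" if "u \<in> C" "v \<in> C" "u \<noteq> v" for u v
    using assms(3)[OF that] by (intro disjoint_ballI) simp
  then have "disjoint_family_on (\<lambda>x. ball x \<delta> \<inter> X) C"
    unfolding disjoint_family_on_def by blast
  then show ?thesis
    unfolding packing_number_def using assms by (intro SUP_upper) auto
qed

text \<open>
  The number of intervals alive at scale \<open>t\<close> is at most the packing number at a scale
  comparable to \<open>t\<close>, hence at most a constant times \<open>t powr - d\<close>. An interval of length at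
  least \<open>t\<close> is alive at scale \<open>t / 2\<close>, so up to a constant the same bound holds for
  the number of long intervals, and the sum of the powers is bounded by the \<open>p\<close>-series with
  \<open>p = \<alpha> / d < 1\<close>, which has fewer terms than there are points.
\<close>

lemma E0_le_powr:
  fixes X :: "'a::metric_space set"
  assumes X: "bounded X" and d: "upper_box_dim X < ereal d" and \<alpha>: "0 < \<alpha>" "\<alpha> < d"
    and F: "F \<in> {cech, rips}"
  obtains K where "0 < K"
    "\<And>S. finite S \<Longrightarrow> S \<noteq> {} \<Longrightarrow> S \<subseteq> X \<Longrightarrow>
       E0 TYPE('k::field) F \<alpha> S \<le> K * real (card S) powr (1 - \<alpha> / d)"
proof -
  obtain L where L: "0 < L" "\<And>u v. u \<in> X \<Longrightarrow> v \<in> X \<Longrightarrow> dist u v < L"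
  proof -
    obtain e where "\<forall>u\<in>X. \<forall>v\<in>X. dist u v \<le> e"
      using X unfolding bounded_two_points by blast
    then show thesis by (intro that[of "\<bar>e\<bar> + 1"]) fastforce+
  qed
  obtain \<delta> where \<delta>: "0 < \<delta>"
    "\<And>\<epsilon>. 0 < \<epsilon> \<Longrightarrow> \<epsilon> \<le> \<delta> \<Longrightarrow> packing_number \<epsilon> X \<le> ereal (\<epsilon> powr - d)"
    using packing_number_le_powr[OF d] by blast
  \<comment> \<open>The packing bound holds below \<open>\<delta>\<close> only; since scales above \<open>L\<close> do not occur, \<open>c * t\<close> is always in that range.\<close>
  define c where "c = min (1 / 2) (\<delta> / L)"
  have c: "0 < c" using \<delta>(1) L(1) by (simp add: c_def)
  have packing: "real (card C) \<le> c powr - d * t powr - d"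
    if "finite C" "C \<subseteq> X" "0 < t" "t < L" and sep: "\<And>u v. u \<in> C \<Longrightarrow> v \<in> C \<Longrightarrow> u \<noteq> v \<Longrightarrow> t \<le> dist u v" for C t
  proof -
    have "c * t \<le> (\<delta> / L) * L"
      using that \<delta>(1) L(1) c by (intro mult_mono) (auto simp: c_def)
    then have "c * t \<le> \<delta>" using L(1) by simp
    have "c \<le> 1 / 2" unfolding c_def by (rule min.cobounded1)
    then have "2 * (c * t) \<le> t" using that(3) by simp
    then have "2 * (c * t) \<le> dist u v" if "u \<in> C" "v \<in> C" "u \<noteq> v" for u v
      using sep[OF that] by linarith
    then have "ereal (real (card C)) \<le> packing_number (c * t) X"
      by (rule card_separated_le[OF that(1,2)])
    also have "\<dots> \<le> ereal ((c * t) powr - d)"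
      using \<open>c * t \<le> \<delta>\<close> c that(3) by (intro \<delta>(2)) simp_all
    finally show ?thesis using c that(3) by (simp add: powr_mult)
  qed
  define B where "B = c powr - d * 2 powr d"
  have B: "0 < B" using c by (simp add: B_def)
  define s where "s = \<alpha> / d"
  have s: "0 < s" "s < 1" using \<alpha> by (auto simp: s_def)
  define K where "K = B powr s / (1 - s)"
  show thesis
  proof (rule that[of K])
    show "0 < K" using B s by (simp add: K_def)
  next
    fix S :: "'a set" assume S: "finite S" "S \<noteq> {}" "S \<subseteq> X"
    obtain Is where Is: "mset Is = PH0 TYPE('k) (F S)"
      "\<And>I. I \<in> set Is \<Longrightarrow> I \<noteq> {}" "\<And>I. I \<in> set Is \<Longrightarrow> I \<subseteq> {0<..}"
      "\<And>I s t. I \<in> set Is \<Longrightarrow> 0 < s \<Longrightarrow> s \<le> t \<Longrightarrow> t \<in> I \<Longrightarrow> s \<in> I"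
      "\<And>t. 0 < t \<Longrightarrow> \<exists>C\<subseteq>S. card {j. j < length Is \<and> t \<in> Is ! j} < card C \<and>
           (\<forall>u\<in>C. \<forall>v\<in>C. u \<noteq> v \<longrightarrow> t \<le> dist u v)"
      by (fact PH0_counting[where 'k = 'k, OF S(1,2) F])
    have alive: "t < L" if "j < length Is" "t \<in> Is ! j" for t j
    proof (rule ccontr)
      assume "\<not> t < L"
      then have "0 < t" using L(1) by simp
      then obtain C where C: "C \<subseteq> S" "card {j. j < length Is \<and> t \<in> Is ! j} < card C"
        "\<forall>u\<in>C. \<forall>v\<in>C. u \<noteq> v \<longrightarrow> t \<le> dist u v" using Is(5)[OF \<open>0 < t\<close>] by blast
      have "card {j. j < length Is \<and> t \<in> Is ! j} \<noteq> 0" using that by auto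
      then have "\<not> card C \<le> Suc 0" using C(2) by linarith
      then obtain u v where "u \<in> C" "v \<in> C" "u \<noteq> v"
        using card_le_Suc0_iff_eq[of C] finite_subset[OF C(1) S(1)] by blast
      then show False using C L(2)[of u v] S(3) \<open>\<not> t < L\<close> by fastforce
    qed
    have count: "real (card {j. j < length Is \<and> t \<in> Is ! j}) \<le> c powr - d * t powr - d" if t: "0 < t" for t
    proof (cases "t < L")
      case True
      obtain C where C: "C \<subseteq> S" "card {j. j < length Is \<and> t \<in> Is ! j} < card C"
        "\<forall>u\<in>C. \<forall>v\<in>C. u \<noteq> v \<longrightarrow> t \<le> dist u v" using Is(5)[OF t] by blast
      have "real (card C) \<le> c powr - d * t powr - d"
        using C S t True finite_subset by (intro packing) auto
      then show ?thesis using C(2) by linarith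
    next
      case False
      then have "{j. j < length Is \<and> t \<in> Is ! j} = {}" using alive by blast
      then show ?thesis by (simp only: card.empty) simp
    qed
    have len: "length Is \<le> card S"
    proof (cases "Is = []")
      case False
      have "\<exists>t>0. t \<in> I" if "I \<in> set Is" for I
        using Is(2)[OF that] Is(3)[OF that] by (auto simp: subset_iff)
      then obtain f where f: "\<And>I. I \<in> set Is \<Longrightarrow> 0 < f I \<and> f I \<in> I" by metis
      define t where "t = Min (f ` set Is)"
      have t: "t \<in> f ` set Is" unfolding t_def using False by (intro Min_in) auto
      then have "0 < t" using f by auto
      have le: "t \<le> f I" if "I \<in> set Is" for I unfolding t_def using that by simp
      have "t \<in> Is ! j" if "j < length Is" for j
        using Is(4)[of "Is ! j" t "f (Is ! j)"] \<open>0 < t\<close> le f that by simp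
      then have "{j. j < length Is \<and> t \<in> Is ! j} = {..<length Is}" by auto
      moreover obtain C where "C \<subseteq> S" "card {j. j < length Is \<and> t \<in> Is ! j} < card C"
        using Is(5)[OF \<open>0 < t\<close>] by blast
      ultimately show ?thesis using card_mono[OF S(1), of C] by simp
    qed simp
    define b where "b j = interval_length (Is ! j)" for j
    have bdd: "bdd_above (Is ! j)" "bdd_below (Is ! j)" "0 \<le> Inf (Is ! j)" "Is ! j \<noteq> {}"
      if j: "j < length Is" for j
    proof -
      have I: "Is ! j \<in> set Is" using j by simp
      show "Is ! j \<noteq> {}" using Is(2)[OF I] .
      show "bdd_above (Is ! j)" using alive[OF j] by (intro bdd_aboveI[of _ L]) (auto intro: less_imp_le)
      show "bdd_below (Is ! j)" using Is(3)[OF I] by (intro bdd_belowI[of _ 0]) (auto intro: less_imp_le)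
      show "0 \<le> Inf (Is ! j)" using Is(2)[OF I] Is(3)[OF I] by (intro cInf_greatest) (auto intro: less_imp_le)
    qed
    have b0: "0 \<le> b j" if "j < length Is" for j
      using cInf_le_cSup[OF bdd(4,1,2)[OF that]] by (simp add: b_def interval_length_def)
    have half: "t / 2 \<in> Is ! j" if j: "j < length Is" and t: "0 < t" "t \<le> b j" for j t
    proof -
      have "t / 2 < Sup (Is ! j)" using t bdd(3)[OF j] by (simp add: b_def interval_length_def)
      then obtain u where "u \<in> Is ! j" "t / 2 < u"
        using less_cSup_iff[OF bdd(4,1)[OF j]] by blast
      then show ?thesis using Is(4)[of "Is ! j" "t / 2" u] t j by simp
    qed
    have countb: "real (card {j\<in>{..<length Is}. t \<le> b j}) \<le> B * t powr - d" if t: "0 < t" for t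
    proof -
      have "card {j\<in>{..<length Is}. t \<le> b j} \<le> card {j. j < length Is \<and> t / 2 \<in> Is ! j}"
        using half t by (intro card_mono) auto
      also have "real \<dots> \<le> c powr - d * (t / 2) powr - d" using t by (intro count) simp
      also have "\<dots> = B * t powr - d"
        using t by (simp add: B_def powr_divide powr_minus field_simps)
      finally show ?thesis by simp
    qed
    have "E0 TYPE('k) F \<alpha> S = (\<Sum>j<length Is. b j powr \<alpha>)"
    proof -
      have "E0 TYPE('k) F \<alpha> S = sum_list (map (\<lambda>I. interval_length I powr \<alpha>) Is)"
        unfolding E0_def Is(1)[symmetric] by (simp flip: mset_map add: sum_mset_sum_list)
      then show ?thesis by (simp add: sum_list_sum_nth b_def atLeast0LessThan)
    qed
    also have "\<dots> \<le> B powr s * (\<Sum>k=1..card {..<length Is}. real k powr - s)"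
      unfolding s_def using b0 countb B \<alpha> by (intro sum_powr_le_of_counting) auto
    also have "\<dots> \<le> B powr s * (real (length Is) powr (1 - s) / (1 - s))"
      using sum_powr_neg_le[OF s] by (intro mult_left_mono) auto
    also have "\<dots> = K * real (length Is) powr (1 - s)" by (simp add: K_def)
    also have "\<dots> \<le> K * real (card S) powr (1 - s)"
      using len s \<open>0 < B\<close> by (intro mult_left_mono powr_mono2) (auto simp: K_def)
    finally show "E0 TYPE('k) F \<alpha> S \<le> K * real (card S) powr (1 - \<alpha> / d)" by (simp add: s_def)
  qed
qed

section \<open>The growth exponent\<close>

text \<open>
  The bound on the energy holds for every sample, so it passes to the expectation. A sample
  of size \<open>n\<close> may have repeated points, hence its set has at most \<open>n\<close> elements.
\<close>

lemma growth_exponent_le: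
  fixes X :: "'a::metric_space set"
  assumes X: "bounded X" and \<mu>: "prob_space \<mu>" "space \<mu> = X"
    and F: "F \<in> {cech, rips}" and \<alpha>: "0 < \<alpha>" "\<alpha> < d" and d: "upper_box_dim X < ereal d"
  shows "growth_exponent TYPE('k::field) F \<alpha> \<mu> \<le> ereal (1 - \<alpha> / d)"
proof -
  obtain K where K: "0 < K" "\<And>S. finite S \<Longrightarrow> S \<noteq> {} \<Longrightarrow> S \<subseteq> X \<Longrightarrow>
       E0 TYPE('k::field) F \<alpha> S \<le> K * real (card S) powr (1 - \<alpha> / d)"
    using E0_le_powr[OF X d \<alpha> F] by blast
  define q where "q = 1 - \<alpha> / d"
  have q: "0 < q" using \<alpha> by (simp add: q_def)
  have expected: "expected_E0 TYPE('k) F \<alpha> \<mu> n \<le> ennreal (K * real n powr q)" if n: "1 \<le> n" for n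
  proof -
    interpret P: prob_space "\<Pi>\<^sub>M j\<in>{..<n}. \<mu>" by (intro prob_space_PiM \<mu>)
    have "E0 TYPE('k) F \<alpha> (x ` {..<n}) \<le> K * real n powr q"
      if "x \<in> space (\<Pi>\<^sub>M j\<in>{..<n}. \<mu>)" for x
    proof -
      have "x ` {..<n} \<subseteq> X" using that \<mu>(2) by (auto simp: space_PiM)
      moreover have "{..<n} \<noteq> {}" using n by (metis One_nat_def lessThan_empty_iff not_one_le_zero)
      ultimately have "E0 TYPE('k) F \<alpha> (x ` {..<n}) \<le> K * real (card (x ` {..<n})) powr q"
        using K(2)[of "x ` {..<n}"] by (simp add: q_def)
      also have "\<dots> \<le> K * real n powr q"
        using card_image_le[of "{..<n}" x] q K(1) by (intro mult_left_mono powr_mono2) auto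
      finally show ?thesis .
    qed
    then have "expected_E0 TYPE('k) F \<alpha> \<mu> n \<le>
        (\<integral>\<^sup>+ x. ennreal (K * real n powr q) \<partial>(\<Pi>\<^sub>M j\<in>{..<n}. \<mu>))"
      unfolding expected_E0_def by (intro nn_integral_mono ennreal_leI) auto
    then show ?thesis by (simp add: P.emeasure_space_1)
  qed
  have bound: "eln (enn2ereal (expected_E0 TYPE('k) F \<alpha> \<mu> n)) / ereal (ln (real n))
      \<le> ereal (ln K / ln (real n) + q)" if n: "2 \<le> n" for n
  proof -
    have ln: "0 < ln (real n)" using n by simp
    have "enn2ereal (expected_E0 TYPE('k) F \<alpha> \<mu> n) \<le> enn2ereal (ennreal (K * real n powr q))"
      using expected[of n] n by (simp add: less_eq_ennreal.rep_eq)
    then have "enn2ereal (expected_E0 TYPE('k) F \<alpha> \<mu> n) \<le> ereal (K * real n powr q)"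
      using K(1) by simp
    then have "eln (enn2ereal (expected_E0 TYPE('k) F \<alpha> \<mu> n)) \<le> ereal (ln (K * real n powr q))"
      using K(1) n by (intro eln_le) auto
    then have "eln (enn2ereal (expected_E0 TYPE('k) F \<alpha> \<mu> n)) / ereal (ln (real n))
        \<le> ereal (ln (K * real n powr q)) / ereal (ln (real n))"
      using ln by (intro ereal_divide_right_mono) auto
    also have "\<dots> = ereal (ln K / ln (real n) + q)"
      using ln K(1) n by (simp add: ln_mult ln_powr add_divide_distrib)
    finally show ?thesis .
  qed
  have "((\<lambda>n. ln K / ln (real n) + q) \<longlongrightarrow> 0 + q) sequentially"
    by (intro tendsto_add tendsto_const real_tendsto_divide_at_top[OF tendsto_const]
        filterlim_compose[OF ln_at_top filterlim_real_sequentially])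
  then have "limsup (\<lambda>n. ereal (ln K / ln (real n) + q)) = ereal q"
    by (intro lim_imp_Limsup) (auto simp: lim_ereal)
  moreover have "growth_exponent TYPE('k) F \<alpha> \<mu> \<le> limsup (\<lambda>n. ereal (ln K / ln (real n) + q))"
    unfolding growth_exponent_def using bound
    by (intro Limsup_mono eventually_mono[OF eventually_ge_at_top[of 2]]) auto
  ultimately show ?thesis by (simp add: q_def)
qed

theorem proposition11:
  fixes X :: "'a::metric_space set"
    and \<mu> :: "'a measure"
    and F :: "'a set \<Rightarrow> real \<Rightarrow> 'a set set"
    and \<alpha> :: real
  assumes "bounded X"
    and "prob_space \<mu>"
    and "sets \<mu> = sets (restrict_space borel X)"
    and "F \<in> {cech, rips}"
    and "0 < \<alpha>"
    and "ereal \<alpha> < upper_box_dim X"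
  shows "PH0_dim TYPE('k::field) F \<alpha> \<mu> \<le> upper_box_dim X"
proof (cases "upper_box_dim X = \<infinity>")
  case False
  then obtain d where d: "upper_box_dim X = ereal d" "\<alpha> < d"
    using assms(6) by (cases "upper_box_dim X") auto
  have space: "space \<mu> = X"
    using sets_eq_imp_space_eq[OF assms(3)] by (simp add: space_restrict_space)
  define \<beta> where "\<beta> = growth_exponent TYPE('k) F \<alpha> \<mu>"
  have le: "\<beta> \<le> ereal (1 - \<alpha> / d')" if "d < d'" for d'
    unfolding \<beta>_def using that d assms by (intro growth_exponent_le[OF _ _ space]) auto
  \<comment> \<open>The packing bound needs an exponent above the dimension; let it tend to the dimension.\<close>
  have "\<beta> \<le> ereal (1 - \<alpha> / d)"
  proof (rule tendsto_lowerbound)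
    show "((\<lambda>d'. ereal (1 - \<alpha> / d')) \<longlongrightarrow> ereal (1 - \<alpha> / d)) (at_right d)"
      using d assms(5) by (auto intro!: tendsto_intros)
    show "eventually (\<lambda>d'. \<beta> \<le> ereal (1 - \<alpha> / d')) (at_right d)"
      using le by (auto simp: eventually_at_filter)
  qed simp
  show ?thesis
  proof (cases \<beta>)
    case (real r)
    then have "\<alpha> / d \<le> 1 - r" using \<open>\<beta> \<le> _\<close> by simp
    moreover have "0 < \<alpha> / d" using d assms(5) by simp
    ultimately have "r < 1" by linarith
    then have "\<alpha> / (1 - r) \<le> d"
      using \<open>\<alpha> / d \<le> 1 - r\<close> d assms(5) by (simp add: field_simps)
    then show ?thesis
      using real d(1) \<open>r < 1\<close> by (simp add: PH0_dim_def Let_def one_ereal_def flip: \<beta>_def)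
  next
    case MInf
    then show ?thesis using d assms(5) by (simp add: PH0_dim_def flip: \<beta>_def)
  qed (use \<open>\<beta> \<le> _\<close> in simp)
qed simp

end
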